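(* Let $G$ be a $\overline{C}$-group, with a fixed $\overline{C}$-type presentation $\Pi$. Then the structure group $G^{\mathcal{D}}$, with the maps $\pi\colon G^{\mathcal{D}}\to G$ and $\mathrm{Ab}_{\mathrm{f}}\colon G^{\mathcal{D}}\to\mathbb{Z}^{\mathfrak{C}_{\mathrm{fg}}(G)}$, is the pullback $$G^{\mathcal{D}}\ \cong\ G\underset{\mathrm{Ab}_{\mathrm{f}},\,G_{\mathrm{f}},\,\overline{\pi}}{\times}\mathbb{Z}^{\mathfrak{C}_{\mathrm{fg}}(G)}=\{(a,x)\in G\times \mathbb{Z}^{\mathfrak{C}_{\mathrm{fg}}(G)}\mid \mathrm{Ab}_{\mathrm{f}}(a)=\overline{\pi}(x)\},$$ where $G_{\mathrm{f}}=\bigoplus_{\mathcal{O}\in\mathfrak{C}_{\mathrm{fg}}(G)}\mathbb{Z}_{k(\mathcal{O})}$; $\overline{\pi}\colon\mathbb{Z}^{\mathfrak{C}_{\mathrm{fg}}(G)}\twoheadrightarrow G_{\mathrm{f}}$ is the projection of each copy of $\mathbb{Z}$ indexed by $\mathcal{O}\in\mathfrak{C}_{\mathrm{fg}}(G)$ onto $\mathbb{Z}_{k(\mathcal{O})}$; and $\mathrm{Ab}_{\mathrm{f}}\colon G\to G_{\mathrm{f}}$ is the composition of the abelianisation map $G\twoheadrightarrow\mathbb{Z}^{\mathfrak{C}_{\mathrm{ig}}(G)}\oplus G_{\mathrm{f}}$ with the projection onto $G_{\mathrm{f}}$.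
   Context: A $\overline{C}$-group is a group $G$ admitting a presentation $\Pi$ (a $\overline{C}$-type presentation), with some generator set $\Gamma$, in which every relation is either a conjugation relation $b^{-1}ab=c$ with $a,b,c\in\Gamma$, or a power relation $a^k=1$ with $a\in\Gamma$, $k\ge 2$; there is at most one power relation per conjugacy class of $G$ (i.e., for each conjugacy class $\mathcal{O}$ of $G$, at most one power relation $a^k=1$ has $a\in\mathcal{O}$). $\mathfrak{C}_{\mathrm{g}}(G)$ is the set of conjugacy classes of $G$ containing some generator from $\Gamma$; it is the disjoint union of $\mathfrak{C}_{\mathrm{fg}}(G)$ (classes whose elements have finite order) and $\mathfrak{C}_{\mathrm{ig}}(G)$ (classes whose elements have infinite order). For $\mathcal{O}\in\mathfrak{C}_{\mathrm{fg}}(G)$, $k(\mathcal{O})$ is the order of its elements, which equals the exponent in the only power relation $a^k=1$ of $\Pi$ with $a\in\mathcal{O}$. For a set $X$, $\mathbb{Z}^X$ is the free abelian group with basis $(c_x)_{x\in X}$ (direct sum), and $\mathbb{Z}_k=\mathbb{Z}/k\mathbb{Z}$. From $\Pi$, the abelianisation of $G$ is identified with $\mathbb{Z}^{\mathfrak{C}_{\mathrm{ig}}(G)}\oplus G_{\mathrm{f}}$, a generator $a\in\Gamma$ lying in a class $\mathcal{O}$ being sent to the standard generator of the component indexed by $\mathcal{O}$. The Dehn quandle $\Gamma^G$ is the union of the $G$-conjugacy classes of the elements of $\Gamma$, with $a\triangleleft b=b^{-1}ab$, and $G^{\mathcal{D}}=\langle e_a,\ a\in\Gamma^G\mid e_ae_b=e_be_{a\triangleleft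 b},\ a,b\in\Gamma^G\rangle$. The map $\pi\colon G^{\mathcal{D}}\to G$ is $e_a\mapsto a$. The map $\mathrm{Ab}_{\mathrm{f}}\colon G^{\mathcal{D}}\to\mathbb{Z}^{\mathfrak{C}_{\mathrm{fg}}(G)}$ sends $e_a$, $a\in\mathcal{O}$, to $c_{\mathcal{O}}$ if $\mathcal{O}\in\mathfrak{C}_{\mathrm{fg}}(G)$ and to $0$ if $\mathcal{O}\in\mathfrak{C}_{\mathrm{ig}}(G)$. *)

theory Defs
  imports "HOL-Algebra.Algebra"
begin

section \<open>Groups given by generators and relations\<close>

datatype 'x letter = Gen 'x | GenInv 'x

type_synonym 'x word = "'x letter list"

definition words :: "'x set \<Rightarrow> 'x word set" where
  "words S = lists (Gen ` S \<union> GenInv ` S)"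

text \<open>A relation \<open>u = v\<close> is the pair \<open>(u, v)\<close> of words. The following is the least congruence
  on the monoid \<open>words S\<close> that makes \<open>GenInv x\<close> inverse to \<open>Gen x\<close> and identifies the two sides
  of every relation in \<open>R\<close>.\<close>

inductive pres_cong :: "'x set \<Rightarrow> ('x word \<times> 'x word) set \<Rightarrow> 'x word \<Rightarrow> 'x word \<Rightarrow> bool"
  for S :: "'x set" and R :: "('x word \<times> 'x word) set" where
  refl: "u \<in> words S \<Longrightarrow> pres_cong S R u u"
| sym: "pres_cong S R u v \<Longrightarrow> pres_cong S R v u"
| trans: "pres_cong S R u v \<Longrightarrow> pres_cong S R v w \<Longrightarrow> pres_cong S R u w"
| append: "pres_cong S R u v \<Longrightarrow> pres_cong S R u' v' \<Longrightarrow> pres_cong S R (u @ u') (v @ v')"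
| right_inverse: "x \<in> S \<Longrightarrow> pres_cong S R [Gen x, GenInv x] []"
| left_inverse: "x \<in> S \<Longrightarrow> pres_cong S R [GenInv x, Gen x] []"
| relation: "(u, v) \<in> R \<Longrightarrow> u \<in> words S \<Longrightarrow> v \<in> words S \<Longrightarrow> pres_cong S R u v"

definition word_class ::
  "'x set \<Rightarrow> ('x word \<times> 'x word) set \<Rightarrow> 'x word \<Rightarrow> 'x word set" where
  "word_class S R w = {v. pres_cong S R w v}"

definition presented_group ::
  "'x set \<Rightarrow> ('x word \<times> 'x word) set \<Rightarrow> 'x word set monoid" where
  "presented_group S R =
     \<lparr>carrier = word_class S R ` words S,
      monoid.mult = (\<lambda>A B. \<Union>u\<in>A. \<Union>v\<in>B. word_class S R (u @ v)),
      one = word_class S R []\<rparr>"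

text \<open>The generators are formal symbols; \<open>\<iota> x\<close> is the element of \<open>G\<close> named by \<open>x\<close>.\<close>

definition has_presentation ::
  "('a, 'm) monoid_scheme \<Rightarrow> 'x set \<Rightarrow> ('x \<Rightarrow> 'a) \<Rightarrow> ('x word \<times> 'x word) set \<Rightarrow> bool" where
  "has_presentation G S \<iota> R \<longleftrightarrow>
     (\<exists>\<phi> \<in> iso (presented_group S R) G. \<forall>x\<in>S. \<phi> (word_class S R [Gen x]) = \<iota> x)"

text \<open>The homomorphism with prescribed values \<open>f x\<close> on generators \<open>\<iota> x\<close>, \<open>x \<in> S\<close>.\<close>

definition hom_on_gens ::
  "('a, 'm) monoid_scheme \<Rightarrow> ('b, 'n) monoid_scheme \<Rightarrow> 'x set \<Rightarrow> ('x \<Rightarrow> 'a) \<Rightarrow> ('x \<Rightarrow> 'b) \<Rightarrow> 'a \<Rightarrow> 'b"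
  where
  "hom_on_gens G H S \<iota> f =
     (THE h. h \<in> extensional (carrier G) \<and> h \<in> hom G H \<and> (\<forall>x\<in>S. h (\<iota> x) = f x))"


section \<open>Presentations of type $\overline{C}$\<close>

definition conj_by :: "('a, 'm) monoid_scheme \<Rightarrow> 'a \<Rightarrow> 'a \<Rightarrow> 'a" where
  "conj_by G a b = inv\<^bsub>G\<^esub> b \<otimes>\<^bsub>G\<^esub> a \<otimes>\<^bsub>G\<^esub> b"

definition conj_class :: "('a, 'm) monoid_scheme \<Rightarrow> 'a \<Rightarrow> 'a set" where
  "conj_class G a = conj_by G a ` carrier G"

definition conj_relation :: "'x \<Rightarrow> 'x \<Rightarrow> 'x \<Rightarrow> 'x word \<times> 'x word" where
  "conj_relation a b c = ([GenInv b, Gen a, Gen b], [Gen c])"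

definition power_relation :: "'x \<Rightarrow> nat \<Rightarrow> 'x word \<times> 'x word" where
  "power_relation a k = (replicate k (Gen a), [])"

definition Cbar_presentation ::
  "('a, 'm) monoid_scheme \<Rightarrow> 'x set \<Rightarrow> ('x \<Rightarrow> 'a) \<Rightarrow> ('x word \<times> 'x word) set \<Rightarrow> bool" where
  "Cbar_presentation G S \<iota> R \<longleftrightarrow>
     has_presentation G S \<iota> R \<and>
     (\<forall>r\<in>R. (\<exists>a\<in>S. \<exists>b\<in>S. \<exists>c\<in>S. r = conj_relation a b c) \<or>
             (\<exists>a\<in>S. \<exists>k\<ge>2. r = power_relation a k)) \<and>
     (\<forall>a\<in>S. \<forall>b\<in>S. \<forall>k\<ge>2. \<forall>l\<ge>2.
        power_relation a k \<in> R \<and> power_relation b l \<in> R \<and>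
        conj_class G (\<iota> a) = conj_class G (\<iota> b) \<longrightarrow> a = b \<and> k = l)"


section \<open>Classes of generators and the abelianisation\<close>

text \<open>From here on \<open>\<Gamma>\<close> is the set of generators as elements of \<open>G\<close>.\<close>

definition gen_classes :: "('a, 'm) monoid_scheme \<Rightarrow> 'a set \<Rightarrow> 'a set set" where
  "gen_classes G \<Gamma> = conj_class G ` \<Gamma>"

definition fin_gen_classes :: "('a, 'm) monoid_scheme \<Rightarrow> 'a set \<Rightarrow> 'a set set" where
  "fin_gen_classes G \<Gamma> =
     {C \<in> gen_classes G \<Gamma>. \<forall>a\<in>C. \<exists>n::nat. n > 0 \<and> a [^]\<^bsub>G\<^esub> n = \<one>\<^bsub>G\<^esub>}"

definition inf_gen_classes :: "('a, 'm) monoid_scheme \<Rightarrow> 'a set \<Rightarrow> 'a set set" where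
  "inf_gen_classes G \<Gamma> =
     {C \<in> gen_classes G \<Gamma>. \<forall>a\<in>C. \<forall>n::nat. n > 0 \<longrightarrow> a [^]\<^bsub>G\<^esub> n \<noteq> \<one>\<^bsub>G\<^esub>}"

definition class_order :: "('a, 'm) monoid_scheme \<Rightarrow> 'a set \<Rightarrow> nat" where
  "class_order G C = (THE k. \<forall>a\<in>C. group.ord G a = k)"

definition G_fin :: "('a, 'm) monoid_scheme \<Rightarrow> 'a set \<Rightarrow> ('a set \<Rightarrow> int) monoid" where
  "G_fin G \<Gamma> = sum_group (fin_gen_classes G \<Gamma>) (\<lambda>C. integer_mod_group (class_order G C))"

definition abel_target ::
  "('a, 'm) monoid_scheme \<Rightarrow> 'a set \<Rightarrow> (('a set \<Rightarrow>\<^sub>0 int) \<times> ('a set \<Rightarrow> int)) monoid" where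
  "abel_target G \<Gamma> = free_Abelian_group (inf_gen_classes G \<Gamma>) \<times>\<times> G_fin G \<Gamma>"

definition std_gen ::
  "('a, 'm) monoid_scheme \<Rightarrow> 'a set \<Rightarrow> 'a set \<Rightarrow> ('a set \<Rightarrow>\<^sub>0 int) \<times> ('a set \<Rightarrow> int)" where
  "std_gen G \<Gamma> C =
     (if C \<in> inf_gen_classes G \<Gamma> then (frag_of C, \<one>\<^bsub>G_fin G \<Gamma>\<^esub>)
      else (0, \<lambda>D\<in>fin_gen_classes G \<Gamma>. if D = C then 1 else 0))"

definition abel_iso ::
  "('a, 'm) monoid_scheme \<Rightarrow> 'a set \<Rightarrow> 'a set \<Rightarrow> ('a set \<Rightarrow>\<^sub>0 int) \<times> ('a set \<Rightarrow> int)" where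
  "abel_iso G \<Gamma> =
     (THE \<Phi>. \<Phi> \<in> extensional (carrier (G Mod derived G (carrier G))) \<and>
             \<Phi> \<in> iso (G Mod derived G (carrier G)) (abel_target G \<Gamma>) \<and>
             (\<forall>a\<in>\<Gamma>. \<Phi> (derived G (carrier G) #>\<^bsub>G\<^esub> a) = std_gen G \<Gamma> (conj_class G a)))"

definition abel_map ::
  "('a, 'm) monoid_scheme \<Rightarrow> 'a set \<Rightarrow> 'a \<Rightarrow> ('a set \<Rightarrow>\<^sub>0 int) \<times> ('a set \<Rightarrow> int)" where
  "abel_map G \<Gamma> g = abel_iso G \<Gamma> (derived G (carrier G) #>\<^bsub>G\<^esub> g)"

definition Ab_fin :: "('a, 'm) monoid_scheme \<Rightarrow> 'a set \<Rightarrow> 'a \<Rightarrow> ('a set \<Rightarrow> int)" where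
  "Ab_fin G \<Gamma> g = snd (abel_map G \<Gamma> g)"

definition pi_bar ::
  "('a, 'm) monoid_scheme \<Rightarrow> 'a set \<Rightarrow> ('a set \<Rightarrow>\<^sub>0 int) \<Rightarrow> ('a set \<Rightarrow> int)" where
  "pi_bar G \<Gamma> x =
     (\<lambda>C\<in>fin_gen_classes G \<Gamma>. Poly_Mapping.lookup x C mod int (class_order G C))"


section \<open>The Dehn quandle and its structure group\<close>

definition dehn_quandle :: "('a, 'm) monoid_scheme \<Rightarrow> 'a set \<Rightarrow> 'a set" where
  "dehn_quandle G \<Gamma> = (\<Union>a\<in>\<Gamma>. conj_class G a)"

definition dehn_relations :: "('a, 'm) monoid_scheme \<Rightarrow> 'a set \<Rightarrow> ('a word \<times> 'a word) set" where
  "dehn_relations G \<Gamma> =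
     {([Gen a, Gen b], [Gen b, Gen (conj_by G a b)]) | a b.
        a \<in> dehn_quandle G \<Gamma> \<and> b \<in> dehn_quandle G \<Gamma>}"

definition dehn_group :: "('a, 'm) monoid_scheme \<Rightarrow> 'a set \<Rightarrow> 'a word set monoid" where
  "dehn_group G \<Gamma> = presented_group (dehn_quandle G \<Gamma>) (dehn_relations G \<Gamma>)"

definition dehn_gen :: "('a, 'm) monoid_scheme \<Rightarrow> 'a set \<Rightarrow> 'a \<Rightarrow> 'a word set" where
  "dehn_gen G \<Gamma> a = word_class (dehn_quandle G \<Gamma>) (dehn_relations G \<Gamma>) [Gen a]"

definition dehn_pi :: "('a, 'm) monoid_scheme \<Rightarrow> 'a set \<Rightarrow> 'a word set \<Rightarrow> 'a" where
  "dehn_pi G \<Gamma> =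
     hom_on_gens (dehn_group G \<Gamma>) G (dehn_quandle G \<Gamma>) (dehn_gen G \<Gamma>) (\<lambda>a. a)"

definition dehn_Ab_fin ::
  "('a, 'm) monoid_scheme \<Rightarrow> 'a set \<Rightarrow> 'a word set \<Rightarrow> ('a set \<Rightarrow>\<^sub>0 int)" where
  "dehn_Ab_fin G \<Gamma> =
     hom_on_gens (dehn_group G \<Gamma>) (free_Abelian_group (fin_gen_classes G \<Gamma>))
       (dehn_quandle G \<Gamma>) (dehn_gen G \<Gamma>)
       (\<lambda>a. if conj_class G a \<in> fin_gen_classes G \<Gamma> then frag_of (conj_class G a) else 0)"


definition pullback_group ::
  "('a, 'm) monoid_scheme \<Rightarrow> ('b, 'n) monoid_scheme \<Rightarrow> ('a \<Rightarrow> 'c) \<Rightarrow> ('b \<Rightarrow> 'c) \<Rightarrow> ('a \<times> 'b) monoid"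
  where
  "pullback_group G H f h =
     (G \<times>\<times> H)\<lparr>carrier := {(a, x). a \<in> carrier G \<and> x \<in> carrier H \<and> f a = h x}\<rparr>"

end

theory Submission
  imports Defs
begin

text \<open>
  Conjugation by \<open>y\<close> in the structure group \<open>D\<close> of the Dehn quandle sends \<open>e a\<close> to
  \<open>e (a \<triangleleft> \<pi> y)\<close>. Hence, for \<open>a\<close> in a class \<open>C\<close> of finite order \<open>k\<close>, the power
  \<open>(e a)\<^sup>k\<close> is central in \<open>D\<close> and depends only on \<open>C\<close>, and \<open>D\<close> is generated by the
  \<open>e (\<iota> x)\<close>. Modulo these central powers the generators \<open>e (\<iota> x)\<close> satisfy the defining
  relations of \<open>G\<close>, so the kernel of \<open>\<pi>\<close> is the image of a homomorphism \<open>\<kappa>\<close> from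
  \<open>\<int>\<close>-combinations of finite classes to the centre of \<open>D\<close>. Since \<open>Ab\<close> maps \<open>\<kappa> C\<close> to \<open>k C\<close>
  and the multiples of the \<open>k C\<close> make up the kernel of \<open>\<pi>\<close>-bar, the pair
  \<open>(\<pi>, Ab)\<close> is injective on the kernel of \<open>\<pi>\<close> and hits the whole pullback.
\<close>

section \<open>Words and presented groups\<close>

text \<open>The statement speaks through definite descriptions (\<open>hom_on_gens\<close>,
  \<open>class_order\<close>, \<open>abel_iso\<close>), so existence and uniqueness come first, and
  two of them need real arguments. \<open>class_order\<close> is an order in \<open>G\<close>,
  whereas the presentation supplies an exponent. That no smaller power vanishes, and that a
  generator without a power relation in its class has infinite order, is seen by mapping
  \<open>G\<close> to cyclic groups; here the restriction to one power relation per class enters.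
  \<open>abel_iso\<close> exists only if nothing outside the derived subgroup dies in
  \<open>abel_target\<close>; to see this, words are evaluated in a free abelian group on the
  classes that maps to both sides. A further obstacle is that \<open>D\<close> is presented on all
  of \<open>Q\<close> but \<open>G\<close> on \<open>S\<close>. Once the
  \<open>e (\<iota> x)\<close> are known to generate \<open>D\<close>, an element of the kernel of
  \<open>\<pi>\<close> is a word over \<open>S\<close> that is trivial in \<open>G\<close>, and the
  congruence making it so can be evaluated in a quotient of \<open>D\<close>. Since several symbols
  may name one element or share a class, maps defined on classes rest on chosen
  representatives.\<close>

primrec eval_word :: "('b, 'n) monoid_scheme \<Rightarrow> ('x \<Rightarrow> 'b) \<Rightarrow> 'x word \<Rightarrow> 'b" where
  "eval_word H f [] = \<one>\<^bsub>H\<^esub>"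
| "eval_word H f (l # w) =
     (case l of Gen x \<Rightarrow> f x | GenInv x \<Rightarrow> inv\<^bsub>H\<^esub> f x) \<otimes>\<^bsub>H\<^esub> eval_word H f w"

lemma words_Nil [simp]: "[] \<in> words S"
  by (simp add: words_def)

lemma words_Cons [simp]:
  "l # w \<in> words S \<longleftrightarrow> (\<exists>x\<in>S. l = Gen x \<or> l = GenInv x) \<and> w \<in> words S"
  by (auto simp: words_def)

lemma words_append [simp]: "u @ v \<in> words S \<longleftrightarrow> u \<in> words S \<and> v \<in> words S"
  by (simp add: words_def)

lemma words_replicate_Gen: "x \<in> S \<Longrightarrow> replicate k (Gen x) \<in> words S"
  by (induction k) auto

lemma words_induct [consumes 1, case_names Nil Gen GenInv]:
  assumes "w \<in> words S" "P []"
    and "\<And>x w. \<lbrakk>x \<in> S; w \<in> words S; P w\<rbrakk> \<Longrightarrow> P (Gen x # w)"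
    and "\<And>x w. \<lbrakk>x \<in> S; w \<in> words S; P w\<rbrakk> \<Longrightarrow> P (GenInv x # w)"
  shows "P w"
  using assms(1)
proof (induction w)
  case Nil
  show ?case by fact
next
  case (Cons l w)
  then show ?case
    using assms(3,4) by fastforce
qed

lemma (in group) eval_word_closed:
  assumes "f \<in> S \<rightarrow> carrier G" "w \<in> words S"
  shows "eval_word G f w \<in> carrier G"
  using assms(2) by (induction rule: words_induct) (use assms(1) in auto)

lemma (in group) eval_word_append:
  assumes f: "f \<in> S \<rightarrow> carrier G" and "u \<in> words S" "v \<in> words S"
  shows "eval_word G f (u @ v) = eval_word G f u \<otimes> eval_word G f v"
  using assms(2)
proof (induction rule: words_induct)
  case Nil
  show ?case
    by (simp add: eval_word_closed [OF f] assms)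
next
  case (Gen x w)
  moreover have "f x \<in> carrier G"
    using f Gen by blast
  ultimately show ?case
    by (simp add: m_assoc eval_word_closed [OF f] assms)
next
  case (GenInv x w)
  moreover have "f x \<in> carrier G"
    using f GenInv by blast
  ultimately show ?case
    by (simp add: m_assoc eval_word_closed [OF f] assms)
qed

lemma (in group) eval_word_replicate:
  "f x \<in> carrier G \<Longrightarrow> eval_word G f (replicate k (Gen x)) = f x [^] k"
proof (induction k)
  case (Suc k)
  then show ?case
    using nat_pow_Suc2 [of "f x" k] by simp
qed simp

lemma eval_word_cong:
  assumes "w \<in> words S" "\<And>x. x \<in> S \<Longrightarrow> f x = g x"
  shows "eval_word H f w = eval_word H g w"
  using assms(1) by (induction rule: words_induct) (simp_all add: assms(2))

lemma hom_eval_word: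
  assumes "group G" "group H" "h \<in> hom G H" and f: "f \<in> S \<rightarrow> carrier G" and "w \<in> words S"
  shows "h (eval_word G f w) = eval_word H (\<lambda>x. h (f x)) w"
proof -
  interpret group_hom G H h
    using assms by (simp add: group_hom_def group_hom_axioms_def)
  show ?thesis
    using \<open>w \<in> words S\<close>
  proof (induction rule: words_induct)
    case (Gen x w)
    then show ?case
      using f by (simp add: G.eval_word_closed [OF f] Pi_iff)
  next
    case (GenInv x w)
    then show ?case
      using f by (simp add: G.eval_word_closed [OF f] Pi_iff)
  qed simp
qed

section \<open>The congruence and the group of its classes\<close>

lemma pres_cong_words: "pres_cong S R u v \<Longrightarrow> u \<in> words S \<and> v \<in> words S"
  by (induction rule: pres_cong.induct) auto

text \<open>Having equal values in a group is itself a congruence that respects inverse letters, and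
  \<open>pres_cong\<close> is the least one containing \<open>R\<close>; so it suffices to check
  \<open>R\<close>. This is the core of von Dyck's theorem.\<close>

lemma pres_cong_eval_word:
  assumes "group H" and f: "f \<in> S \<rightarrow> carrier H"
    and R: "\<And>u v. \<lbrakk>(u, v) \<in> R; u \<in> words S; v \<in> words S\<rbrakk> \<Longrightarrow> eval_word H f u = eval_word H f v"
    and "pres_cong S R u v"
  shows "eval_word H f u = eval_word H f v"
proof -
  interpret group H by fact
  from \<open>pres_cong S R u v\<close> show ?thesis
  proof (induction rule: pres_cong.induct)
    case (append u v u' v')
    then show ?case
      by (metis pres_cong_words eval_word_append [OF f])
  qed (use f R in \<open>auto simp: Pi_iff\<close>)
qed

lemma word_class_eq_iff:
  assumes "u \<in> words S"
  shows "word_class S R u = word_class S R v \<longleftrightarrow> pres_cong S R u v"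
proof
  assume "word_class S R u = word_class S R v"
  moreover have "u \<in> word_class S R u"
    using assms by (simp add: word_class_def pres_cong.refl)
  ultimately show "pres_cong S R u v"
    by (simp add: word_class_def pres_cong.sym)
next
  assume "pres_cong S R u v"
  then show "word_class S R u = word_class S R v"
    unfolding word_class_def by (blast intro: pres_cong.sym pres_cong.trans)
qed

lemma carrier_presented_group: "carrier (presented_group S R) = word_class S R ` words S"
  by (simp add: presented_group_def)

lemma word_class_closed [simp]:
  "w \<in> words S \<Longrightarrow> word_class S R w \<in> carrier (presented_group S R)"
  by (simp add: carrier_presented_group)

lemma one_presented_group: "\<one>\<^bsub>presented_group S R\<^esub> = word_class S R []"
  by (simp add: presented_group_def)

lemma mult_presented_group:
  assumes "u \<in> words S" "v \<in> words S"
  shows "word_class S R u \<otimes>\<^bsub>presented_group S R\<^esub> word_class S R v = word_class S R (u @ v)"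
proof -
  \<comment> \<open>All members of the double union that defines the product are one and the same
    class, because the congruence respects concatenation. The union collapses as both classes are
    nonempty.\<close>
  have eq: "word_class S R (u' @ v') = word_class S R (u @ v)"
    if "u' \<in> word_class S R u" "v' \<in> word_class S R v" for u' v'
  proof -
    have "pres_cong S R (u @ v) (u' @ v')"
      using that by (simp add: word_class_def pres_cong.append)
    then show ?thesis
      using assms by (subst eq_commute) (simp add: word_class_eq_iff)
  qed
  have "u \<in> word_class S R u" "v \<in> word_class S R v"
    using assms by (simp_all add: word_class_def pres_cong.refl)
  then show ?thesis
    unfolding presented_group_def monoid.simps using eq by blast
qed

lemma group_presented_group: "group (presented_group S R)"
proof (rule groupI)
  let ?P = "presented_group S R"
  show "A \<otimes>\<^bsub>?P\<^esub> B \<in> carrier ?P" if "A \<in> carrier ?P" "B \<in> carrier ?P" for A B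
    using that by (auto simp: carrier_presented_group mult_presented_group)
  show "\<one>\<^bsub>?P\<^esub> \<in> carrier ?P"
    by (simp add: one_presented_group)
  show "A \<otimes>\<^bsub>?P\<^esub> B \<otimes>\<^bsub>?P\<^esub> C = A \<otimes>\<^bsub>?P\<^esub> (B \<otimes>\<^bsub>?P\<^esub> C)"
    if "A \<in> carrier ?P" "B \<in> carrier ?P" "C \<in> carrier ?P" for A B C
    using that by (auto simp: carrier_presented_group mult_presented_group)
  show "\<one>\<^bsub>?P\<^esub> \<otimes>\<^bsub>?P\<^esub> A = A" if "A \<in> carrier ?P" for A
    using that by (auto simp: carrier_presented_group mult_presented_group one_presented_group)
  \<comment> \<open>\<open>groupI\<close> asks for a left inverse only. It grows with the word: the
    inverse of each new first letter goes to the right end of \<open>v\<close>, where it meets that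
    letter.\<close>
  have "\<exists>v\<in>words S. pres_cong S R (v @ w) []" if "w \<in> words S" for w
    using that
  proof (induction rule: words_induct)
    case Nil
    show ?case
      by (auto intro!: bexI [of _ "[]"] pres_cong.refl)
  next
    case (Gen x w)
    then obtain v where v: "v \<in> words S" "pres_cong S R (v @ w) []"
      by blast
    have "pres_cong S R (v @ ([GenInv x, Gen x] @ w)) (v @ ([] @ w))"
      using v Gen by (intro pres_cong.append pres_cong.refl pres_cong.left_inverse) auto
    then have "pres_cong S R ((v @ [GenInv x]) @ Gen x # w) []"
      using v(2) by (auto intro: pres_cong.trans)
    then show ?case
      using v(1) Gen by (intro bexI [of _ "v @ [GenInv x]"]) auto
  next
    case (GenInv x w)
    then obtain v where v: "v \<in> words S" "pres_cong S R (v @ w) []"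
      by blast
    have "pres_cong S R (v @ ([Gen x, GenInv x] @ w)) (v @ ([] @ w))"
      using v GenInv by (intro pres_cong.append pres_cong.refl pres_cong.right_inverse) auto
    then have "pres_cong S R ((v @ [Gen x]) @ GenInv x # w) []"
      using v(2) by (auto intro: pres_cong.trans)
    then show ?case
      using v(1) GenInv by (intro bexI [of _ "v @ [Gen x]"]) auto
  qed
  then show "\<exists>B\<in>carrier ?P. B \<otimes>\<^bsub>?P\<^esub> A = \<one>\<^bsub>?P\<^esub>" if "A \<in> carrier ?P" for A
    using that
    by (force simp: carrier_presented_group mult_presented_group one_presented_group word_class_eq_iff)
qed

lemma inv_word_class_Gen:
  assumes "x \<in> S"
  shows "inv\<^bsub>presented_group S R\<^esub> word_class S R [Gen x] = word_class S R [GenInv x]"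
proof -
  interpret group "presented_group S R"
    by (rule group_presented_group)
  have "word_class S R [GenInv x] \<otimes>\<^bsub>presented_group S R\<^esub> word_class S R [Gen x]
      = \<one>\<^bsub>presented_group S R\<^esub>"
    using assms
    by (simp add: mult_presented_group one_presented_group word_class_eq_iff pres_cong.left_inverse)
  then show ?thesis
    using assms by (intro inv_equality) auto
qed

text \<open>Reduces every statement about homomorphisms on classes of words to
  \<open>hom_eval_word\<close>.\<close>

lemma eval_word_presented_group:
  assumes "w \<in> words S"
  shows "eval_word (presented_group S R) (\<lambda>x. word_class S R [Gen x]) w = word_class S R w"
  using assms
  by (induction rule: words_induct)
    (simp_all add: one_presented_group mult_presented_group inv_word_class_Gen)

section \<open>Homomorphisms out of a presented group\<close>

lemma hom_presented_group:
  assumes "group H" "h \<in> hom (presented_group S R) H" "w \<in> words S"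
  shows "h (word_class S R w) = eval_word H (\<lambda>x. h (word_class S R [Gen x])) w"
  using hom_eval_word [OF group_presented_group assms(1,2) _ assms(3), of "\<lambda>x. word_class S R [Gen x]"]
  by (simp add: eval_word_presented_group assms(3))

lemma hom_presented_group_eqI:
  assumes "group H" "h \<in> hom (presented_group S R) H" "h' \<in> hom (presented_group S R) H"
    and "\<And>x. x \<in> S \<Longrightarrow> h (word_class S R [Gen x]) = h' (word_class S R [Gen x])"
    and "y \<in> carrier (presented_group S R)"
  shows "h y = h' y"
proof -
  obtain w where w: "w \<in> words S" "y = word_class S R w"
    using assms(5) by (auto simp: carrier_presented_group)
  show ?thesis
    unfolding w(2) hom_presented_group [OF assms(1,2) w(1)] hom_presented_group [OF assms(1,3) w(1)]
    using w(1) assms(4) by (rule eval_word_cong)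
qed

lemma presented_group_universal:
  assumes "group H" and f: "f \<in> S \<rightarrow> carrier H"
    and R: "\<And>u v. \<lbrakk>(u, v) \<in> R; u \<in> words S; v \<in> words S\<rbrakk> \<Longrightarrow> eval_word H f u = eval_word H f v"
  obtains h where "h \<in> hom (presented_group S R) H"
    "\<And>w. w \<in> words S \<Longrightarrow> h (word_class S R w) = eval_word H f w"
proof
  interpret group H by fact
  \<comment> \<open>A class is evaluated at an arbitrary member; by
    \<open>pres_cong_eval_word\<close> the choice does not matter.\<close>
  let ?h = "\<lambda>A. eval_word H f (SOME w. w \<in> A)"
  show h: "?h (word_class S R w) = eval_word H f w" if "w \<in> words S" for w
  proof -
    have "w \<in> word_class S R w"
      using that by (simp add: word_class_def pres_cong.refl)
    then have "(SOME v. v \<in> word_class S R w) \<in> word_class S R w"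
      by (rule someI)
    then show ?thesis
      using pres_cong_eval_word [OF assms] by (metis mem_Collect_eq word_class_def)
  qed
  show "?h \<in> hom (presented_group S R) H"
    by (rule homI)
      (auto simp: carrier_presented_group mult_presented_group h eval_word_closed [OF f]
        eval_word_append [OF f])
qed

text \<open>The description in \<open>hom_on_gens\<close> needs a unique candidate: the universal
  property provides one, the values on generators fix it on the carrier, and extensionality fixes it
  elsewhere. Both \<open>dehn_pi\<close> and \<open>dehn_Ab_fin\<close> are instances.\<close>

lemma hom_on_gens_presented_group:
  assumes "group H" and f: "f \<in> S \<rightarrow> carrier H"
    and R: "\<And>u v. \<lbrakk>(u, v) \<in> R; u \<in> words S; v \<in> words S\<rbrakk> \<Longrightarrow> eval_word H f u = eval_word H f v"
  defines "h \<equiv> hom_on_gens (presented_group S R) H S (\<lambda>x. word_class S R [Gen x]) f"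
  shows "h \<in> hom (presented_group S R) H"
    and "\<And>x. x \<in> S \<Longrightarrow> h (word_class S R [Gen x]) = f x"
proof -
  let ?P = "presented_group S R"
  interpret group H by fact
  let ?Q = "\<lambda>h. h \<in> extensional (carrier ?P) \<and> h \<in> hom ?P H \<and> (\<forall>x\<in>S. h (word_class S R [Gen x]) = f x)"
  obtain g where g: "g \<in> hom ?P H" "\<And>w. w \<in> words S \<Longrightarrow> g (word_class S R w) = eval_word H f w"
    using presented_group_universal [OF assms(1-3)] by blast
  have "?Q (restrict g (carrier ?P))"
    using g f by (auto simp: group.hom_restrict group_presented_group Pi_iff)
  moreover have "h' = restrict g (carrier ?P)" if "?Q h'" for h'
  proof
    fix y
    show "h' y = restrict g (carrier ?P) y"
    proof (cases "y \<in> carrier ?P")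
      case True
      have "h' y = g y"
      proof (rule hom_presented_group_eqI [OF \<open>group H\<close> _ g(1) _ True])
        show "h' (word_class S R [Gen x]) = g (word_class S R [Gen x])" if "x \<in> S" for x
          using \<open>?Q h'\<close> that f g(2) [of "[Gen x]"] by (simp add: Pi_iff)
      qed (use that in blast)
      then show ?thesis
        using True by simp
    next
      case False
      then show ?thesis
        using that by (simp add: extensional_def)
    qed
  qed
  ultimately have "?Q h"
    unfolding h_def hom_on_gens_def by (rule theI)
  then show "h \<in> hom ?P H" and "\<And>x. x \<in> S \<Longrightarrow> h (word_class S R [Gen x]) = f x"
    by blast+
qed

section \<open>Words and generated subgroups\<close>

lemma (in group) eval_word_in_subgroup:
  assumes "subgroup K G" "f \<in> S \<rightarrow> K" "w \<in> words S"
  shows "eval_word G f w \<in> K"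
proof -
  interpret K: subgroup K G by fact
  show ?thesis
    using assms(3)
  proof (induction rule: words_induct)
    case (Gen x w)
    then show ?case
      using assms(2) by (simp add: Pi_iff)
  next
    case (GenInv x w)
    then show ?case
      using assms(2) by (simp add: Pi_iff)
  qed simp
qed

lemma (in group) eval_word_inverse:
  assumes f: "f \<in> S \<rightarrow> carrier G" and "w \<in> words S"
  shows "\<exists>v\<in>words S. eval_word G f v = inv eval_word G f w"
  using assms(2)
proof (induction rule: words_induct)
  case Nil
  show ?case
    by (auto intro!: bexI [of _ "[]"])
next
  case (Gen x w)
  then obtain v where v: "v \<in> words S" "eval_word G f v = inv eval_word G f w"
    by blast
  have "f x \<in> carrier G"
    using f Gen by auto
  then have "eval_word G f (v @ [GenInv x]) = inv eval_word G f (Gen x # w)"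
    using v Gen by (simp add: eval_word_append [OF f] eval_word_closed [OF f] inv_mult_group)
  then show ?case
    using v(1) Gen by (intro bexI [of _ "v @ [GenInv x]"]) auto
next
  case (GenInv x w)
  then obtain v where v: "v \<in> words S" "eval_word G f v = inv eval_word G f w"
    by blast
  have "f x \<in> carrier G"
    using f GenInv by auto
  then have "eval_word G f (v @ [Gen x]) = inv eval_word G f (GenInv x # w)"
    using v GenInv by (simp add: eval_word_append [OF f] eval_word_closed [OF f] inv_mult_group)
  then show ?case
    using v(1) GenInv by (intro bexI [of _ "v @ [Gen x]"]) auto
qed

text \<open>Together with \<open>eval_word_in_subgroup\<close> this turns generation into closure:
  to write all elements as words in \<open>f\<close>, it is enough to find a generating set inside
  this subgroup. \<open>D_gens\<close> uses it that way.\<close>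

lemma (in group) subgroup_eval_word:
  assumes f: "f \<in> S \<rightarrow> carrier G"
  shows "subgroup (eval_word G f ` words S) G"
proof (rule subgroupI)
  show "eval_word G f ` words S \<subseteq> carrier G"
    using eval_word_closed [OF f] by blast
  show "eval_word G f ` words S \<noteq> {}"
    using words_Nil by blast
  show "inv a \<in> eval_word G f ` words S" if a: "a \<in> eval_word G f ` words S" for a
  proof -
    obtain w where w: "w \<in> words S" "a = eval_word G f w"
      using a by blast
    obtain v where "v \<in> words S" "eval_word G f v = inv a"
      using eval_word_inverse [OF f w(1)] w(2) by blast
    then show ?thesis
      by (metis imageI)
  qed
  show "a \<otimes> b \<in> eval_word G f ` words S"
    if ab: "a \<in> eval_word G f ` words S" "b \<in> eval_word G f ` words S" for a b
  proof -
    obtain u v where "u \<in> words S" "a = eval_word G f u" "v \<in> words S" "b = eval_word G f v"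
      using ab by blast
    then show ?thesis
      using eval_word_append [OF f, of u v] by (intro image_eqI [of _ _ "u @ v"]) simp_all
  qed
qed

section \<open>Conjugation and centre\<close>

lemma (in group) conj_by_closed [simp]:
  "\<lbrakk>a \<in> carrier G; b \<in> carrier G\<rbrakk> \<Longrightarrow> conj_by G a b \<in> carrier G"
  by (simp add: conj_by_def)

lemma (in group) conj_by_one [simp]: "a \<in> carrier G \<Longrightarrow> conj_by G a \<one> = a"
  by (simp add: conj_by_def)

lemma (in group) conj_by_mult:
  assumes "a \<in> carrier G" "b \<in> carrier G" "c \<in> carrier G"
  shows "conj_by G (conj_by G a b) c = conj_by G a (b \<otimes> c)"
  using assms by (simp add: conj_by_def inv_mult_group m_assoc)

text \<open>Removes the inverse from a conjugation. With \<open>c = a\<close> it expresses that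
  \<open>a\<close> and \<open>b\<close> commute, which is how centrality is read off from
  conjugation later.\<close>

lemma (in group) conj_by_eq_iff:
  assumes "a \<in> carrier G" "b \<in> carrier G" "c \<in> carrier G"
  shows "conj_by G a b = c \<longleftrightarrow> a \<otimes> b = b \<otimes> c"
  using assms inv_solve_left' [of c b "a \<otimes> b"] by (simp add: conj_by_def m_assoc)

lemma (in group) conj_by_pow:
  assumes "a \<in> carrier G" "b \<in> carrier G"
  shows "conj_by G (a [^] n) b = conj_by G a b [^] (n::nat)"
proof (induction n)
  case 0
  show ?case
    using assms by (simp add: conj_by_def)
next
  case (Suc n)
  have "a [^] n \<otimes> b = b \<otimes> conj_by G a b [^] n"
    using Suc assms by (simp add: conj_by_eq_iff)
  moreover have "a \<otimes> b = b \<otimes> conj_by G a b"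
    using conj_by_eq_iff [of a b "conj_by G a b"] assms by simp
  ultimately have "a [^] Suc n \<otimes> b = b \<otimes> conj_by G a b [^] Suc n"
    using assms by (metis conj_by_closed m_assoc nat_pow_Suc nat_pow_closed)
  then show ?case
    using assms by (subst conj_by_eq_iff) auto
qed

lemma (in group) ord_conj_by:
  assumes "a \<in> carrier G" "b \<in> carrier G"
  shows "ord (conj_by G a b) = ord a"
proof -
  have "conj_by G a b [^] n = \<one> \<longleftrightarrow> a [^] n = \<one>" for n :: nat
  proof -
    have "conj_by G a b [^] n = \<one> \<longleftrightarrow> a [^] n \<otimes> b = b \<otimes> \<one>"
      using assms by (subst conj_by_pow [symmetric]) (simp_all add: conj_by_eq_iff)
    also have "\<dots> \<longleftrightarrow> a [^] n = \<one>"
      using assms by simp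
    finally show ?thesis .
  qed
  then show ?thesis
    using assms ord_unique [of "conj_by G a b" "ord a"] pow_eq_id [of a] by simp
qed

lemma (in group) conj_class_self: "a \<in> carrier G \<Longrightarrow> a \<in> conj_class G a"
  unfolding conj_class_def using conj_by_one by (metis image_eqI one_closed)

lemma (in group) conj_class_conj_by:
  assumes "a \<in> carrier G" "b \<in> carrier G"
  shows "conj_class G (conj_by G a b) = conj_class G a"
proof
  show "conj_class G (conj_by G a b) \<subseteq> conj_class G a"
    using assms by (auto simp: conj_class_def conj_by_mult)
  show "conj_class G a \<subseteq> conj_class G (conj_by G a b)"
  proof
    fix d
    assume "d \<in> conj_class G a"
    then obtain c where c: "c \<in> carrier G" "d = conj_by G a c"
      by (auto simp: conj_class_def)
    then have "d = conj_by G (conj_by G a b) (inv b \<otimes> c)"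
      using assms by (simp add: conj_by_mult m_assoc [symmetric])
    then show "d \<in> conj_class G (conj_by G a b)"
      using assms c by (simp add: conj_class_def)
  qed
qed

lemma (in group) conj_class_subset: "a \<in> carrier G \<Longrightarrow> conj_class G a \<subseteq> carrier G"
  by (auto simp: conj_class_def)

lemma (in group) ord_conj_class: "\<lbrakk>x \<in> carrier G; a \<in> conj_class G x\<rbrakk> \<Longrightarrow> ord a = ord x"
  by (auto simp: conj_class_def ord_conj_by)

lemma (in comm_group) conj_by_eq: "\<lbrakk>a \<in> carrier G; b \<in> carrier G\<rbrakk> \<Longrightarrow> conj_by G a b = a"
  by (simp add: conj_by_eq_iff m_comm)

text \<open>Used for cosets of the derived subgroup, which therefore do not see which generator
  represents a class.\<close>

lemma hom_conj_by:
  assumes "group G" "comm_group H" "h \<in> hom G H" "a \<in> carrier G" "b \<in> carrier G"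
  shows "h (conj_by G a b) = h a"
proof -
  interpret H: comm_group H by fact
  interpret group_hom G H h
    using assms by (simp add: group_hom_def group_hom_axioms_def H.is_group)
  show ?thesis
    using assms(4,5) H.conj_by_eq [of "h a" "h b"] by (simp add: conj_by_def)
qed

section \<open>Centralizers and the centre\<close>

definition centre :: "('a, 'm) monoid_scheme \<Rightarrow> 'a set" where
  "centre G = {z \<in> carrier G. \<forall>y\<in>carrier G. z \<otimes>\<^bsub>G\<^esub> y = y \<otimes>\<^bsub>G\<^esub> z}"

lemma (in group) inv_commutes:
  assumes "z \<in> carrier G" "y \<in> carrier G" "z \<otimes> y = y \<otimes> z"
  shows "inv z \<otimes> y = y \<otimes> inv z"
proof -
  have "conj_by G y (inv z) = y"
  proof -
    have "conj_by G y z = y"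
      using assms by (simp add: conj_by_eq_iff)
    then show ?thesis
      using assms conj_by_mult [of y z "inv z"] by simp
  qed
  then show ?thesis
    using assms by (simp add: conj_by_eq_iff)
qed

lemma (in group) subgroup_centralizer:
  assumes z: "z \<in> carrier G"
  shows "subgroup {y \<in> carrier G. z \<otimes> y = y \<otimes> z} G"
proof (rule subgroupI)
  show "{y \<in> carrier G. z \<otimes> y = y \<otimes> z} \<noteq> {}"
    using z by auto
  show "inv y \<in> {y \<in> carrier G. z \<otimes> y = y \<otimes> z}" if "y \<in> {y \<in> carrier G. z \<otimes> y = y \<otimes> z}" for y
    using that z inv_commutes [of y z] by simp
  show "a \<otimes> b \<in> {y \<in> carrier G. z \<otimes> y = y \<otimes> z}"
    if "a \<in> {y \<in> carrier G. z \<otimes> y = y \<otimes> z}" "b \<in> {y \<in> carrier G. z \<otimes> y = y \<otimes> z}" for a b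
  proof -
    have ab: "a \<in> carrier G" "b \<in> carrier G" "z \<otimes> a = a \<otimes> z" "z \<otimes> b = b \<otimes> z"
      using that by auto
    have "z \<otimes> (a \<otimes> b) = a \<otimes> (z \<otimes> b)"
      using z ab m_assoc [of z a b] m_assoc [of a z b] by simp
    also have "\<dots> = a \<otimes> b \<otimes> z"
      using z ab by (simp add: m_assoc)
    finally show ?thesis
      using ab by simp
  qed
qed blast

text \<open>The centre is an intersection of centralizers, so it inherits its closure properties
  from \<open>subgroup_centralizer\<close>.\<close>

lemma (in group) centre_iff:
  "z \<in> centre G \<longleftrightarrow> z \<in> carrier G \<and> (\<forall>y\<in>carrier G. z \<in> {x \<in> carrier G. y \<otimes> x = x \<otimes> y})"
  by (simp add: centre_def) metis

lemma (in group) subgroup_centre: "subgroup (centre G) G"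
proof (rule subgroupI)
  show "centre G \<subseteq> carrier G"
    by (auto simp: centre_def)
  show "centre G \<noteq> {}"
    using one_closed by (force simp: centre_def)
  show "inv a \<in> centre G" if "a \<in> centre G" for a
    using that subgroup.m_inv_closed [OF subgroup_centralizer] inv_closed unfolding centre_iff by blast
  show "a \<otimes> b \<in> centre G" if "a \<in> centre G" "b \<in> centre G" for a b
    using that subgroup.m_closed [OF subgroup_centralizer] m_closed unfolding centre_iff by blast
qed

text \<open>The universal property of a free abelian group needs a commutative target. The structure
  group is not commutative in general, so \<open>\<kappa>\<close> is first built as a map into this
  subgroup.\<close>

lemma (in group) comm_group_centre: "comm_group (G\<lparr>carrier := centre G\<rparr>)"
proof (rule group.group_comm_groupI)
  show "group (G\<lparr>carrier := centre G\<rparr>)"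
    by (rule subgroup.subgroup_is_group [OF subgroup_centre is_group])
  fix x y
  assume "x \<in> carrier (G\<lparr>carrier := centre G\<rparr>)" "y \<in> carrier (G\<lparr>carrier := centre G\<rparr>)"
  then have "x \<in> centre G" "y \<in> centre G"
    by simp_all
  then have "x \<otimes> y = y \<otimes> x"
    unfolding centre_def by blast
  then show "x \<otimes>\<^bsub>G\<lparr>carrier := centre G\<rparr>\<^esub> y = y \<otimes>\<^bsub>G\<lparr>carrier := centre G\<rparr>\<^esub> x"
    by simp
qed

section \<open>Free abelian groups\<close>

lemma hom_free_Abelian_group_eqI:
  assumes "group H" "h \<in> hom (free_Abelian_group I) H" "h' \<in> hom (free_Abelian_group I) H"
    and "\<And>a. a \<in> I \<Longrightarrow> h (frag_of a) = h' (frag_of a)"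
    and "Poly_Mapping.keys x \<subseteq> I"
  shows "h x = h' x"
proof -
  interpret h: group_hom "free_Abelian_group I" H h
    using assms by (simp add: group_hom_def group_hom_axioms_def)
  interpret h': group_hom "free_Abelian_group I" H h'
    using assms by (simp add: group_hom_def group_hom_axioms_def)
  show ?thesis
    using \<open>Poly_Mapping.keys x \<subseteq> I\<close>
  proof (induction rule: free_Abelian_group_induct [consumes 1, case_names zero diff one])
    case zero
    show ?case
      using h.hom_one h'.hom_one by simp
  next
    case (diff x y)
    have "f (x - y) = f x \<otimes>\<^bsub>H\<^esub> inv\<^bsub>H\<^esub> f y" if "group_hom (free_Abelian_group I) H f" for f
    proof -
      interpret f: group_hom "free_Abelian_group I" H f by fact
      show ?thesis
        using diff f.hom_mult [of x "- y"] f.hom_inv [of y] by simp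
    qed
    from this [OF h.group_hom_axioms] this [OF h'.group_hom_axioms] show ?case
      using diff by simp
  qed (use assms in auto)
qed

lemma hom_free_Abelian_group_in_subgroup:
  assumes "group H" "h \<in> hom (free_Abelian_group I) H" "subgroup K H"
    and "\<And>a. a \<in> I \<Longrightarrow> h (frag_of a) \<in> K"
    and "Poly_Mapping.keys x \<subseteq> I"
  shows "h x \<in> K"
proof -
  interpret h: group_hom "free_Abelian_group I" H h
    using assms by (simp add: group_hom_def group_hom_axioms_def)
  interpret K: subgroup K H by fact
  show ?thesis
    using \<open>Poly_Mapping.keys x \<subseteq> I\<close>
  proof (induction rule: free_Abelian_group_induct [consumes 1, case_names zero diff one])
    case zero
    show ?case
      using h.hom_one by simp
  next
    case (diff x y)
    then have "h (x - y) = h x \<otimes>\<^bsub>H\<^esub> inv\<^bsub>H\<^esub> h y"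
      using h.hom_mult [of x "- y"] h.hom_inv [of y] by simp
    then show ?case
      using diff by simp
  qed (use assms in auto)
qed

text \<open>The diagonal endomorphism with entries \<open>k c\<close>. For
  \<open>k = class_order G\<close> its image is the kernel of \<open>pi_bar\<close>, and it is also
  the composite of \<open>dehn_Ab_fin\<close> with \<open>\<kappa>\<close>; the meeting of these two
  roles settles the pullback.\<close>

definition scale_frag :: "('c \<Rightarrow> nat) \<Rightarrow> ('c \<Rightarrow>\<^sub>0 int) \<Rightarrow> ('c \<Rightarrow>\<^sub>0 int)" where
  "scale_frag k = Poly_Mapping.mapp (\<lambda>c n. int (k c) * n)"

lemma lookup_scale_frag [simp]:
  "Poly_Mapping.lookup (scale_frag k x) c = int (k c) * Poly_Mapping.lookup x c"
  by (auto simp: scale_frag_def lookup_mapp when_def in_keys_iff)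

lemma keys_scale_frag: "Poly_Mapping.keys (scale_frag k x) \<subseteq> Poly_Mapping.keys x"
  unfolding scale_frag_def by (rule keys_mapp_subset)

lemma hom_scale_frag: "scale_frag k \<in> hom (free_Abelian_group I) (free_Abelian_group I)"
proof (rule homI)
  show "scale_frag k x \<in> carrier (free_Abelian_group I)" if "x \<in> carrier (free_Abelian_group I)" for x
    using that keys_scale_frag [of k x] by auto
  show "scale_frag k (x \<otimes>\<^bsub>free_Abelian_group I\<^esub> y)
      = scale_frag k x \<otimes>\<^bsub>free_Abelian_group I\<^esub> scale_frag k y" for x y
    by (simp add: poly_mapping_eqI lookup_add distrib_left)
qed

lemma scale_frag_of: "scale_frag k (frag_of c) = frag_cmul (int (k c)) (frag_of c)"
  by (rule poly_mapping_eqI) simp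

lemma scale_frag_eq_0:
  assumes "\<And>c. c \<in> Poly_Mapping.keys x \<Longrightarrow> k c \<noteq> 0" "scale_frag k x = 0"
  shows "x = 0"
proof (rule poly_mapping_eqI)
  fix c
  have "int (k c) * Poly_Mapping.lookup x c = 0"
    using assms(2) by (metis lookup_scale_frag lookup_zero)
  then show "Poly_Mapping.lookup x c = Poly_Mapping.lookup 0 c"
    using assms(1) [of c] by (cases "c \<in> Poly_Mapping.keys x") (simp_all add: in_keys_iff)
qed

lemma scale_frag_surj:
  assumes "\<And>c. c \<in> Poly_Mapping.keys x \<Longrightarrow> int (k c) dvd Poly_Mapping.lookup x c"
  obtains z where "x = scale_frag k z" "Poly_Mapping.keys z \<subseteq> Poly_Mapping.keys x"
proof
  \<comment> \<open>Coefficientwise division, exact by the divisibility assumption.\<close>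
  let ?z = "Poly_Mapping.mapp (\<lambda>c n. n div int (k c)) x"
  show "Poly_Mapping.keys ?z \<subseteq> Poly_Mapping.keys x"
    by (rule keys_mapp_subset)
  show "x = scale_frag k ?z"
    using assms by (intro poly_mapping_eqI) (auto simp: lookup_mapp when_def in_keys_iff)
qed

lemma (in comm_group) hom_DirProd_mult:
  assumes f: "f \<in> hom H G" and g: "g \<in> hom K G"
  shows "(\<lambda>p. f (fst p) \<otimes> g (snd p)) \<in> hom (H \<times>\<times> K) G"
proof (rule homI)
  show "f (fst p) \<otimes> g (snd p) \<in> carrier G" if "p \<in> carrier (H \<times>\<times> K)" for p
    using that hom_in_carrier [OF f] hom_in_carrier [OF g] by auto
  show "f (fst (p \<otimes>\<^bsub>H \<times>\<times> K\<^esub> p')) \<otimes> g (snd (p \<otimes>\<^bsub>H \<times>\<times> K\<^esub> p'))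
      = (f (fst p) \<otimes> g (snd p)) \<otimes> (f (fst p') \<otimes> g (snd p'))"
    if "p \<in> carrier (H \<times>\<times> K)" "p' \<in> carrier (H \<times>\<times> K)" for p p'
  proof -
    have "fst p \<in> carrier H" "fst p' \<in> carrier H" "snd p \<in> carrier K" "snd p' \<in> carrier K"
      using that by auto
    then show ?thesis
      using hom_in_carrier [OF f] hom_in_carrier [OF g]
      by (simp add: mult_DirProd' hom_mult [OF f] hom_mult [OF g] m_ac)
  qed
qed

section \<open>Orders of the generators\<close>

locale cbar_group = group G for G :: "('a, 'm) monoid_scheme" (structure) +
  fixes S :: "'x set" and \<iota> :: "'x \<Rightarrow> 'a" and R :: "('x word \<times> 'x word) set" and \<Gamma> :: "'a set"
  assumes Cbar: "Cbar_presentation G S \<iota> R" and gens: "\<Gamma> = \<iota> ` S"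
begin

abbreviation cls :: "'x \<Rightarrow> 'a set" where
  "cls x \<equiv> conj_class G (\<iota> x)"

lemma presentation_iso:
  obtains \<phi> where "\<phi> \<in> iso (presented_group S R) G"
    "\<And>w. w \<in> words S \<Longrightarrow> \<phi> (word_class S R w) = eval_word G \<iota> w"
proof -
  obtain \<phi> where \<phi>: "\<phi> \<in> iso (presented_group S R) G" "\<And>x. x \<in> S \<Longrightarrow> \<phi> (word_class S R [Gen x]) = \<iota> x"
    using Cbar by (auto simp: Cbar_presentation_def has_presentation_def)
  then have "\<phi> \<in> hom (presented_group S R) G"
    by (simp add: iso_def)
  then have "\<phi> (word_class S R w) = eval_word G (\<lambda>x. \<phi> (word_class S R [Gen x])) w"
    if "w \<in> words S" for w
    using that by (rule hom_presented_group [OF is_group])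
  also have "eval_word G (\<lambda>x. \<phi> (word_class S R [Gen x])) w = eval_word G \<iota> w" if "w \<in> words S" for w
    using that \<phi>(2) by (rule eval_word_cong)
  finally have "\<phi> (word_class S R w) = eval_word G \<iota> w" if "w \<in> words S" for w
    using that by blast
  then show ?thesis
    using \<phi>(1) that by blast
qed

lemma gen_closed [simp]: "x \<in> S \<Longrightarrow> \<iota> x \<in> carrier G"
proof -
  assume x: "x \<in> S"
  obtain \<phi> where \<phi>: "\<phi> \<in> iso (presented_group S R) G" "\<And>x. x \<in> S \<Longrightarrow> \<phi> (word_class S R [Gen x]) = \<iota> x"
    using Cbar by (auto simp: Cbar_presentation_def has_presentation_def)
  have "word_class S R [Gen x] \<in> carrier (presented_group S R)"
    using x by simp
  with \<phi>(1) have "\<phi> (word_class S R [Gen x]) \<in> carrier G"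
    by (auto simp: iso_def intro: hom_in_carrier)
  then show ?thesis
    using \<phi>(2) [OF x] by simp
qed

lemma gens_closed: "\<iota> \<in> S \<rightarrow> carrier G"
  by simp

lemma eval_gens_surj:
  assumes "g \<in> carrier G"
  obtains w where "w \<in> words S" "g = eval_word G \<iota> w"
proof -
  obtain \<phi> where \<phi>: "\<phi> \<in> iso (presented_group S R) G"
    "\<And>w. w \<in> words S \<Longrightarrow> \<phi> (word_class S R w) = eval_word G \<iota> w"
    using presentation_iso by blast
  then have "g \<in> \<phi> ` word_class S R ` words S"
    using assms by (simp add: Group.iso_iff carrier_presented_group)
  then show ?thesis
    using \<phi>(2) that by auto
qed

text \<open>Left to right, injectivity of the presentation isomorphism says that every relation
  holding in \<open>G\<close> already follows from \<open>R\<close>. The computation of the kernel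
  of \<open>dehn_pi\<close> depends on that direction.\<close>

lemma eval_gens_eq_iff:
  assumes "u \<in> words S" "v \<in> words S"
  shows "eval_word G \<iota> u = eval_word G \<iota> v \<longleftrightarrow> pres_cong S R u v"
proof -
  obtain \<phi> where \<phi>: "\<phi> \<in> iso (presented_group S R) G"
    "\<And>w. w \<in> words S \<Longrightarrow> \<phi> (word_class S R w) = eval_word G \<iota> w"
    using presentation_iso by blast
  then have "inj_on \<phi> (carrier (presented_group S R))"
    by (simp add: Group.iso_iff)
  then have "\<phi> (word_class S R u) = \<phi> (word_class S R v) \<longleftrightarrow> word_class S R u = word_class S R v"
    using assms by (simp add: inj_on_eq_iff)
  then show ?thesis
    using assms \<phi>(2) by (simp add: word_class_eq_iff)
qed

lemma relations_cases:
  assumes "(u, v) \<in> R"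
  obtains (conj) a b c where "a \<in> S" "b \<in> S" "c \<in> S" "u = [GenInv b, Gen a, Gen b]" "v = [Gen c]"
    | (power) a k where "a \<in> S" "k \<ge> 2" "u = replicate k (Gen a)" "v = []" "power_relation a k \<in> R"
proof -
  have "(\<exists>a\<in>S. \<exists>b\<in>S. \<exists>c\<in>S. (u, v) = conj_relation a b c) \<or>
        (\<exists>a\<in>S. \<exists>k\<ge>2. (u, v) = power_relation a k)"
    using assms Cbar unfolding Cbar_presentation_def by blast
  then show ?thesis
    using assms that by (auto simp: conj_relation_def power_relation_def)
qed

lemma relation_words: "(u, v) \<in> R \<Longrightarrow> u \<in> words S \<and> v \<in> words S"
  by (erule relations_cases) (auto simp: words_replicate_Gen)

lemma relation_eval: "(u, v) \<in> R \<Longrightarrow> eval_word G \<iota> u = eval_word G \<iota> v"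
  using relation_words [of u v] by (simp add: eval_gens_eq_iff pres_cong.relation)

lemma power_relation_unique:
  assumes "a \<in> S" "b \<in> S" "2 \<le> k" "2 \<le> l" "power_relation a k \<in> R" "power_relation b l \<in> R"
    "cls a = cls b"
  shows "a = b \<and> k = l"
proof -
  have "\<forall>a\<in>S. \<forall>b\<in>S. \<forall>k\<ge>2. \<forall>l\<ge>2.
      power_relation a k \<in> R \<and> power_relation b l \<in> R \<and> cls a = cls b \<longrightarrow> a = b \<and> k = l"
    using Cbar by (simp add: Cbar_presentation_def)
  then show ?thesis
    using assms by metis
qed

text \<open>Von Dyck's theorem for a commutative target. In a relation \<open>b^-1 a b = c\<close>
  the generators \<open>a\<close> and \<open>c\<close> are conjugate in \<open>G\<close>, so values
  that depend on the class alone respect it; only the power relations remain as a condition.\<close>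

lemma hom_on_classes:
  assumes "comm_group H" and c: "\<And>x. x \<in> S \<Longrightarrow> c (cls x) \<in> carrier H"
    and pow: "\<And>x k. \<lbrakk>x \<in> S; k \<ge> 2; power_relation x k \<in> R\<rbrakk> \<Longrightarrow> c (cls x) [^]\<^bsub>H\<^esub> k = \<one>\<^bsub>H\<^esub>"
  obtains h where "h \<in> hom G H" "\<And>x. x \<in> S \<Longrightarrow> h (\<iota> x) = c (cls x)"
proof -
  interpret H: comm_group H by fact
  let ?P = "presented_group S R"
  have *: "eval_word H (\<lambda>x. c (cls x)) u = eval_word H (\<lambda>x. c (cls x)) v" if "(u, v) \<in> R" for u v
    using that
  proof (cases rule: relations_cases)
    case (conj a b d)
    have "eval_word G \<iota> u = eval_word G \<iota> v"
      by (rule relation_eval) fact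
    then have "\<iota> d = conj_by G (\<iota> a) (\<iota> b)"
      using conj by (simp add: conj_by_def m_assoc)
    then have "cls d = cls a"
      using conj by (simp add: conj_class_conj_by)
    moreover have "inv\<^bsub>H\<^esub> c (cls b) \<otimes>\<^bsub>H\<^esub> (c (cls a) \<otimes>\<^bsub>H\<^esub> c (cls b)) = c (cls a)"
      using c conj H.conj_by_eq [of "c (cls a)" "c (cls b)"] by (simp add: conj_by_def H.m_assoc)
    ultimately show ?thesis
      using conj c by simp
  next
    case (power a k)
    then show ?thesis
      using c pow by (simp add: H.eval_word_replicate)
  qed
  obtain g where g: "g \<in> hom ?P H"
    "\<And>w. w \<in> words S \<Longrightarrow> g (word_class S R w) = eval_word H (\<lambda>x. c (cls x)) w"
    using presented_group_universal [OF H.is_group, of "\<lambda>x. c (cls x)" S R] c * by blast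
  obtain \<phi> where \<phi>: "\<phi> \<in> iso ?P G"
    "\<And>w. w \<in> words S \<Longrightarrow> \<phi> (word_class S R w) = eval_word G \<iota> w"
    using presentation_iso by blast
  let ?h = "g \<circ> inv_into (carrier ?P) \<phi>"
  have "inv_into (carrier ?P) \<phi> \<in> iso G ?P"
    using group.iso_set_sym [OF group_presented_group \<phi>(1)] .
  then have "?h \<in> hom G H"
    using g(1) by (auto simp: iso_def intro: Group.hom_compose)
  moreover have "?h (\<iota> x) = c (cls x)" if "x \<in> S" for x
  proof -
    have "inj_on \<phi> (carrier ?P)"
      using \<phi>(1) by (simp add: Group.iso_iff)
    moreover have "\<iota> x = \<phi> (word_class S R [Gen x])"
      using \<phi>(2) [of "[Gen x]"] that by simp
    ultimately have "inv_into (carrier ?P) \<phi> (\<iota> x) = word_class S R [Gen x]"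
      using that by (simp add: inv_into_f_f)
    then show ?thesis
      using g(2) [of "[Gen x]"] that c by simp
  qed
  ultimately show ?thesis
    using that by blast
qed

text \<open>Send the generators in the class of \<open>x\<close> to \<open>1\<close> and all others
  to \<open>0\<close> in the integers modulo \<open>k\<close>. Power relations in that class have
  exponent \<open>k\<close>, so this extends to \<open>G\<close>, and \<open>\<iota> x\<close> goes
  to an element of order \<open>k\<close>. For \<open>k = 0\<close> the target is the group of all
  integers, which covers infinite order.\<close>

lemma ord_gen_dvd:
  assumes x: "x \<in> S" and "k \<noteq> 1"
    and k: "\<And>a l. \<lbrakk>a \<in> S; l \<ge> 2; power_relation a l \<in> R; cls a = cls x\<rbrakk> \<Longrightarrow> l = k"
  shows "k dvd ord (\<iota> x)"
proof -
  define c where "c C = (if C = cls x then 1 else 0 :: int)" for C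
  \<comment> \<open>For \<open>k = 1\<close> the carrier would be \<open>{0}\<close> and would miss
    the value \<open>1\<close>.\<close>
  have c_closed: "c C \<in> carrier (integer_mod_group k)" for C
    using \<open>k \<noteq> 1\<close> by (simp add: c_def)
  have c_pow: "c (cls a) [^]\<^bsub>integer_mod_group k\<^esub> l = \<one>\<^bsub>integer_mod_group k\<^esub>"
    if "a \<in> S" "l \<ge> 2" "power_relation a l \<in> R" for a l
    using k [OF that] by (simp add: c_def)
  obtain h where h: "h \<in> hom G (integer_mod_group k)" "\<And>a. a \<in> S \<Longrightarrow> h (\<iota> a) = c (cls a)"
    using hom_on_classes [of "integer_mod_group k" c, OF abelian_integer_mod_group c_closed c_pow]
    by blast
  have "h (\<iota> x [^] ord (\<iota> x)) = h (\<iota> x) [^]\<^bsub>integer_mod_group k\<^esub> ord (\<iota> x)"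
    using h(1) x by (intro hom_nat_pow) auto
  then have "int (ord (\<iota> x)) mod int k = 0"
    using h x hom_one [OF h(1)] by (simp add: c_def is_group)
  then show ?thesis
    by presburger
qed

text \<open>The relation bounds the order of \<open>\<iota> a\<close> from above, hence that of its
  conjugate \<open>\<iota> x\<close>. The lower bound is \<open>ord_gen_dvd\<close>, whose condition
  on exponents is the uniqueness clause of the presentation.\<close>

lemma ord_gen_power:
  assumes "x \<in> S" "a \<in> S" "k \<ge> 2" "power_relation a k \<in> R" "cls a = cls x"
  shows "ord (\<iota> x) = k"
proof (rule dvd_antisym)
  have "\<iota> a [^] k = \<one>"
    using relation_eval [of "replicate k (Gen a)" "[]"] assms
    by (simp add: power_relation_def eval_word_replicate)
  then have "ord (\<iota> a) dvd k"
    using assms by (simp add: pow_eq_id)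
  moreover have "\<iota> x \<in> cls a"
    using assms conj_class_self [of "\<iota> x"] by simp
  then have "ord (\<iota> x) = ord (\<iota> a)"
    using assms by (intro ord_conj_class) auto
  ultimately show "ord (\<iota> x) dvd k"
    by simp
  show "k dvd ord (\<iota> x)"
    using assms power_relation_unique by (intro ord_gen_dvd) auto
qed

text \<open>The case \<open>k = 0\<close> of \<open>ord_gen_dvd\<close>, with its condition on
  exponents vacuous; order \<open>0\<close> encodes infinite order.\<close>

lemma ord_gen_no_power:
  assumes "x \<in> S" "\<And>a k. \<lbrakk>a \<in> S; k \<ge> 2; cls a = cls x\<rbrakk> \<Longrightarrow> power_relation a k \<notin> R"
  shows "ord (\<iota> x) = 0"
proof -
  have "0 dvd ord (\<iota> x)"
    by (rule ord_gen_dvd) (use assms in auto)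
  then show ?thesis
    by simp
qed

section \<open>Classes of finite and of infinite order\<close>

lemma gen_classes_iff: "C \<in> gen_classes G \<Gamma> \<longleftrightarrow> (\<exists>x\<in>S. C = cls x)"
  by (auto simp: gen_classes_def gens)

lemma class_order_cls: "x \<in> S \<Longrightarrow> class_order G (cls x) = ord (\<iota> x)"
proof -
  assume x: "x \<in> S"
  have "\<forall>a\<in>cls x. ord a = ord (\<iota> x)"
    using ord_conj_class [OF gen_closed [OF x]] by blast
  moreover have "k = ord (\<iota> x)" if "\<forall>a\<in>cls x. ord a = k" for k
    using bspec [OF that conj_class_self [OF gen_closed [OF x]]] by simp
  ultimately show ?thesis
    unfolding class_order_def by (rule the_equality)
qed

lemma pow_witness_cls:
  assumes "x \<in> S" "a \<in> cls x"
  shows "(\<exists>n::nat. n > 0 \<and> a [^] n = \<one>) \<longleftrightarrow> ord (\<iota> x) \<noteq> 0"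
proof -
  have "a \<in> carrier G" "ord a = ord (\<iota> x)"
    using conj_class_subset [OF gen_closed] ord_conj_class [OF gen_closed] assms by blast+
  then show ?thesis
    using ord_eq_0 [of a] by (metis neq0_conv)
qed

text \<open>The order is constant on a class, so the condition on all elements can be tested at one
  generator.\<close>

lemma fin_gen_classes_iff: "C \<in> fin_gen_classes G \<Gamma> \<longleftrightarrow> (\<exists>x\<in>S. C = cls x \<and> ord (\<iota> x) \<noteq> 0)"
proof -
  have "(\<forall>a\<in>cls x. \<exists>n::nat. n > 0 \<and> a [^] n = \<one>) \<longleftrightarrow> ord (\<iota> x) \<noteq> 0" if "x \<in> S" for x
    using pow_witness_cls [OF that] conj_class_self [OF gen_closed [OF that]] by metis
  then show ?thesis
    unfolding fin_gen_classes_def gen_classes_iff mem_Collect_eq by metis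
qed

lemma inf_gen_classes_iff: "C \<in> inf_gen_classes G \<Gamma> \<longleftrightarrow> (\<exists>x\<in>S. C = cls x \<and> ord (\<iota> x) = 0)"
proof -
  have "(\<forall>a\<in>cls x. \<forall>n::nat. n > 0 \<longrightarrow> a [^] n \<noteq> \<one>) \<longleftrightarrow> ord (\<iota> x) = 0" if "x \<in> S" for x
    using pow_witness_cls [OF that] conj_class_self [OF gen_closed [OF that]] by metis
  then show ?thesis
    unfolding inf_gen_classes_def gen_classes_iff mem_Collect_eq by metis
qed

lemma cls_fin_iff:
  assumes "x \<in> S"
  shows "cls x \<in> fin_gen_classes G \<Gamma> \<longleftrightarrow> ord (\<iota> x) \<noteq> 0"
proof -
  have "ord (\<iota> x) = ord (\<iota> y)" if "y \<in> S" "cls x = cls y" for y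
    using that assms class_order_cls [of x] class_order_cls [of y] by simp
  then show ?thesis
    unfolding fin_gen_classes_iff using assms by metis
qed

lemma cls_inf_iff:
  assumes "x \<in> S"
  shows "cls x \<in> inf_gen_classes G \<Gamma> \<longleftrightarrow> ord (\<iota> x) = 0"
proof -
  have "ord (\<iota> x) = ord (\<iota> y)" if "y \<in> S" "cls x = cls y" for y
    using that assms class_order_cls [of x] class_order_cls [of y] by simp
  then show ?thesis
    unfolding inf_gen_classes_iff using assms by metis
qed

text \<open>Some generator in the class carries a power relation, for otherwise
  \<open>ord_gen_no_power\<close> would give order \<open>0\<close>; its exponent is at least
  \<open>2\<close>. The bound makes \<open>1\<close> a reduced residue and scaling by the class
  orders injective.\<close>

lemma class_order_ge_2:
  assumes "C \<in> fin_gen_classes G \<Gamma>"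
  shows "2 \<le> class_order G C"
proof -
  obtain x where x: "x \<in> S" "C = cls x" "ord (\<iota> x) \<noteq> 0"
    using assms unfolding fin_gen_classes_iff by blast
  then obtain a k where "a \<in> S" "k \<ge> 2" "cls a = cls x" "power_relation a k \<in> R"
    using ord_gen_no_power by metis
  then show ?thesis
    using x ord_gen_power [of x a k] class_order_cls [of x] by simp
qed

section \<open>The finite part of the abelianisation\<close>

abbreviation FinC :: "'a set set" where
  "FinC \<equiv> fin_gen_classes G \<Gamma>"

abbreviation InfC :: "'a set set" where
  "InfC \<equiv> inf_gen_classes G \<Gamma>"

abbreviation Z_fin :: "('a set \<Rightarrow>\<^sub>0 int) monoid" where
  "Z_fin \<equiv> free_Abelian_group FinC"

lemma carrier_G_fin:
  "carrier (G_fin G \<Gamma>) =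
     {x \<in> \<Pi>\<^sub>E C\<in>FinC. {0..<int (class_order G C)}. finite {C \<in> FinC. x C \<noteq> 0}}"
proof -
  have "(\<Pi>\<^sub>E C\<in>FinC. carrier (integer_mod_group (class_order G C)))
      = (\<Pi>\<^sub>E C\<in>FinC. {0..<int (class_order G C)})"
  proof (rule PiE_cong)
    fix C
    assume "C \<in> FinC"
    then show "carrier (integer_mod_group (class_order G C)) = {0..<int (class_order G C)}"
      using class_order_ge_2 [of C] by (simp add: carrier_integer_mod_group)
  qed
  then show ?thesis
    by (simp add: G_fin_def carrier_sum_group)
qed

lemma one_G_fin: "\<one>\<^bsub>G_fin G \<Gamma>\<^esub> = (\<lambda>C\<in>FinC. 0)"
  by (simp add: G_fin_def)

lemma mult_G_fin:
  "x \<otimes>\<^bsub>G_fin G \<Gamma>\<^esub> y = (\<lambda>C\<in>FinC. (x C + y C) mod int (class_order G C))"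
  by (simp add: G_fin_def)

lemma comm_group_G_fin: "comm_group (G_fin G \<Gamma>)"
proof (rule group.group_comm_groupI)
  show "group (G_fin G \<Gamma>)"
    by (simp add: G_fin_def)
qed (simp add: mult_G_fin add.commute)

lemma pi_bar_hom: "pi_bar G \<Gamma> \<in> hom Z_fin (G_fin G \<Gamma>)"
proof (rule homI)
  show "pi_bar G \<Gamma> x \<in> carrier (G_fin G \<Gamma>)" for x
  proof -
    have "{C \<in> FinC. pi_bar G \<Gamma> x C \<noteq> 0} \<subseteq> Poly_Mapping.keys x"
      by (auto simp: pi_bar_def in_keys_iff)
    then have "finite {C \<in> FinC. pi_bar G \<Gamma> x C \<noteq> 0}"
      by (rule finite_subset) simp
    moreover have "0 < int (class_order G C)" if "C \<in> FinC" for C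
      using class_order_ge_2 [OF that] by simp
    ultimately show ?thesis
      by (auto simp: carrier_G_fin pi_bar_def)
  qed
  show "pi_bar G \<Gamma> (x \<otimes>\<^bsub>Z_fin\<^esub> y) = pi_bar G \<Gamma> x \<otimes>\<^bsub>G_fin G \<Gamma>\<^esub> pi_bar G \<Gamma> y" for x y
    unfolding pi_bar_def mult_G_fin by (rule restrict_ext) (simp add: lookup_add mod_add_eq)
qed

text \<open>Rests on \<open>1 mod k = 1\<close> for \<open>k \<ge> 2\<close>. The right side is the
  second component of \<open>std_gen\<close>, which is thereby recognised as a value of
  \<open>pi_bar\<close>.\<close>

lemma pi_bar_frag_of:
  "pi_bar G \<Gamma> (frag_of C) = (\<lambda>D\<in>FinC. if D = C then 1 else 0)"
  unfolding pi_bar_def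
proof (rule restrict_ext)
  fix D
  assume "D \<in> FinC"
  then show "Poly_Mapping.lookup (frag_of C) D mod int (class_order G D) = (if D = C then 1 else 0)"
    using class_order_ge_2 [of D] by auto
qed

lemma pi_bar_surj:
  assumes "t \<in> carrier (G_fin G \<Gamma>)"
  obtains x where "x \<in> carrier Z_fin" "pi_bar G \<Gamma> x = t"
proof -
  \<comment> \<open>The lift consists of the residues themselves, read as integers. They are already
    reduced, and the finite support required in a direct sum makes them a finitely supported
    map.\<close>
  define x where "x = Abs_poly_mapping (\<lambda>C. if C \<in> FinC then t C else 0)"
  have t: "t \<in> (\<Pi>\<^sub>E C\<in>FinC. {0..<int (class_order G C)})" "finite {C \<in> FinC. t C \<noteq> 0}"
    using assms by (auto simp: carrier_G_fin)
  have "{C. (if C \<in> FinC then t C else 0) \<noteq> 0} = {C \<in> FinC. t C \<noteq> 0}"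
    by auto
  then have l: "Poly_Mapping.lookup x = (\<lambda>C. if C \<in> FinC then t C else 0)"
    unfolding x_def using t(2) by (intro lookup_Abs_poly_mapping) simp
  have "Poly_Mapping.keys x \<subseteq> FinC"
    unfolding keys.rep_eq l by auto
  then have "x \<in> carrier Z_fin"
    by simp
  moreover have "pi_bar G \<Gamma> x = t"
  proof
    fix C
    show "pi_bar G \<Gamma> x C = t C"
    proof (cases "C \<in> FinC")
      case True
      then have "t C mod int (class_order G C) = t C"
        using PiE_mem [OF t(1) True] by simp
      then show ?thesis
        using True by (simp add: pi_bar_def l)
    next
      case False
      then show ?thesis
        using PiE_arb [OF t(1) False] by (simp add: pi_bar_def)
    qed
  qed
  ultimately show ?thesis
    using that by blast
qed

lemma pi_bar_kernel:
  assumes "x \<in> carrier Z_fin" "pi_bar G \<Gamma> x = \<one>\<^bsub>G_fin G \<Gamma>\<^esub>"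
  obtains z where "z \<in> carrier Z_fin" "x = scale_frag (class_order G) z"
proof -
  have "int (class_order G C) dvd Poly_Mapping.lookup x C" if "C \<in> Poly_Mapping.keys x" for C
  proof -
    have "C \<in> FinC"
      using that assms(1) by auto
    then show ?thesis
      using fun_cong [OF assms(2), of C] by (simp add: pi_bar_def one_G_fin dvd_eq_mod_eq_0)
  qed
  then obtain z where "x = scale_frag (class_order G) z" "Poly_Mapping.keys z \<subseteq> Poly_Mapping.keys x"
    using scale_frag_surj by blast
  then show ?thesis
    using that assms(1) by auto
qed

lemma pi_bar_scale:
  "pi_bar G \<Gamma> (scale_frag (class_order G) x) = \<one>\<^bsub>G_fin G \<Gamma>\<^esub>"
  unfolding pi_bar_def one_G_fin by (rule restrict_ext) simp

lemma hom_eqI_gens: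
  assumes "group H" "h \<in> hom G H" "h' \<in> hom G H"
    and "\<And>x. x \<in> S \<Longrightarrow> h (\<iota> x) = h' (\<iota> x)" and "g \<in> carrier G"
  shows "h g = h' g"
proof -
  obtain w where w: "w \<in> words S" "g = eval_word G \<iota> w"
    using eval_gens_surj [OF assms(5)] by blast
  have "eval_word H (\<lambda>x. h (\<iota> x)) w = eval_word H (\<lambda>x. h' (\<iota> x)) w"
    using w(1) assms(4) by (rule eval_word_cong)
  then show ?thesis
    using hom_eval_word [OF is_group assms(1,2) gens_closed w(1)]
      hom_eval_word [OF is_group assms(1,3) gens_closed w(1)] w(2) by simp
qed

section \<open>The abelianisation of \<open>G\<close>\<close>

lemma comm_group_abel_target: "comm_group (abel_target G \<Gamma>)"
proof (rule group.group_comm_groupI)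
  interpret fin: comm_group "G_fin G \<Gamma>"
    by (rule comm_group_G_fin)
  show "group (abel_target G \<Gamma>)"
    unfolding abel_target_def by (rule DirProd_group) (simp_all add: fin.is_group)
  show "x \<otimes>\<^bsub>abel_target G \<Gamma>\<^esub> y = y \<otimes>\<^bsub>abel_target G \<Gamma>\<^esub> x"
    if "x \<in> carrier (abel_target G \<Gamma>)" "y \<in> carrier (abel_target G \<Gamma>)" for x y
    using that by (auto simp: abel_target_def add.commute fin.m_comm)
qed

lemma FinC_not_InfC: "C \<in> FinC \<Longrightarrow> C \<notin> InfC"
  by (auto simp: fin_gen_classes_iff cls_inf_iff)

lemma std_gen_fin: "C \<in> FinC \<Longrightarrow> std_gen G \<Gamma> C = (0, pi_bar G \<Gamma> (frag_of C))"
  by (simp add: std_gen_def FinC_not_InfC pi_bar_frag_of)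

lemma std_gen_inf: "C \<in> InfC \<Longrightarrow> std_gen G \<Gamma> C = (frag_of C, \<one>\<^bsub>G_fin G \<Gamma>\<^esub>)"
  by (simp add: std_gen_def)

lemma cls_cases: "x \<in> S \<Longrightarrow> cls x \<in> FinC \<or> cls x \<in> InfC"
  by (auto simp: cls_fin_iff cls_inf_iff)

text \<open>Together with \<open>inf_part_hom\<close> this covers the two summands of the target by
  free abelian groups, so that claims about it can be checked on basis vectors.\<close>

lemma fin_part_hom: "(\<lambda>y. (0, pi_bar G \<Gamma> y)) \<in> hom Z_fin (abel_target G \<Gamma>)"
  unfolding abel_target_def hom_paired using pi_bar_hom by (simp add: hom_def)

lemma inf_part_hom: "(\<lambda>z. (z, \<one>\<^bsub>G_fin G \<Gamma>\<^esub>)) \<in> hom (free_Abelian_group InfC) (abel_target G \<Gamma>)"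
proof -
  interpret fin: comm_group "G_fin G \<Gamma>"
    by (rule comm_group_G_fin)
  show ?thesis
    unfolding abel_target_def hom_paired by (simp add: hom_def)
qed

lemma std_gen_closed: "x \<in> S \<Longrightarrow> std_gen G \<Gamma> (cls x) \<in> carrier (abel_target G \<Gamma>)"
  using cls_cases [of x] hom_in_carrier [OF fin_part_hom, of "frag_of (cls x)"]
    hom_in_carrier [OF inf_part_hom, of "frag_of (cls x)"]
  by (auto simp: std_gen_fin std_gen_inf)

text \<open>The multiple of a basis vector by its class order lies in the image of
  \<open>scale_frag\<close>, which \<open>pi_bar\<close> kills.\<close>

lemma std_gen_pow:
  assumes "C \<in> FinC"
  shows "std_gen G \<Gamma> C [^]\<^bsub>abel_target G \<Gamma>\<^esub> class_order G C = \<one>\<^bsub>abel_target G \<Gamma>\<^esub>"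
proof -
  interpret T: comm_group "abel_target G \<Gamma>"
    by (rule comm_group_abel_target)
  have "(0, pi_bar G \<Gamma> (frag_of C)) [^]\<^bsub>abel_target G \<Gamma>\<^esub> class_order G C
      = (0, pi_bar G \<Gamma> (frag_of C [^]\<^bsub>Z_fin\<^esub> class_order G C))"
    using hom_nat_pow [OF fin_part_hom, of "frag_of C" "class_order G C"] assms
    by (simp add: T.is_group)
  also have "\<dots> = \<one>\<^bsub>abel_target G \<Gamma>\<^esub>"
    by (simp add: abel_target_def pi_bar_scale flip: scale_frag_of)
  finally show ?thesis
    by (simp add: std_gen_fin assms)
qed

lemma abel_hom_exists:
  obtains h where "h \<in> hom G (abel_target G \<Gamma>)" "\<And>x. x \<in> S \<Longrightarrow> h (\<iota> x) = std_gen G \<Gamma> (cls x)"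
proof -
  have pow: "std_gen G \<Gamma> (cls x) [^]\<^bsub>abel_target G \<Gamma>\<^esub> k = \<one>\<^bsub>abel_target G \<Gamma>\<^esub>"
    if "x \<in> S" "k \<ge> 2" "power_relation x k \<in> R" for x k
  proof -
    have "ord (\<iota> x) = k"
      using that by (intro ord_gen_power [of x x]) auto
    then show ?thesis
      using that std_gen_pow [of "cls x"] by (simp add: cls_fin_iff class_order_cls)
  qed
  show ?thesis
    using hom_on_classes [of "abel_target G \<Gamma>" "std_gen G \<Gamma>", OF comm_group_abel_target std_gen_closed pow]
      that by blast
qed

text \<open>The image is a subgroup containing every standard generator, hence both
  summands.\<close>

lemma abel_hom_surj:
  assumes h: "h \<in> hom G (abel_target G \<Gamma>)" "\<And>x. x \<in> S \<Longrightarrow> h (\<iota> x) = std_gen G \<Gamma> (cls x)"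
  shows "h ` carrier G = carrier (abel_target G \<Gamma>)"
proof
  interpret T: comm_group "abel_target G \<Gamma>"
    by (rule comm_group_abel_target)
  interpret fin: comm_group "G_fin G \<Gamma>"
    by (rule comm_group_G_fin)
  interpret h: group_hom G "abel_target G \<Gamma>" h
    using h(1) by (simp add: group_hom_def group_hom_axioms_def T.is_group is_group)
  show "h ` carrier G \<subseteq> carrier (abel_target G \<Gamma>)"
    by auto
  have K: "subgroup (h ` carrier G) (abel_target G \<Gamma>)"
    by (rule h.subgroup_img_is_subgroup) (rule subgroup_self)
  have std_img: "std_gen G \<Gamma> (cls x) \<in> h ` carrier G" if "x \<in> S" for x
    using h(2) [OF that] that by (metis gen_closed imageI)
  show "carrier (abel_target G \<Gamma>) \<subseteq> h ` carrier G"
  proof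
    fix p
    assume "p \<in> carrier (abel_target G \<Gamma>)"
    then obtain z t where p: "p = (z, t)" "Poly_Mapping.keys z \<subseteq> InfC" "t \<in> carrier (G_fin G \<Gamma>)"
      by (auto simp: abel_target_def)
    obtain y where y: "Poly_Mapping.keys y \<subseteq> FinC" "pi_bar G \<Gamma> y = t"
      using pi_bar_surj [OF p(3)] by auto
    have "(z, \<one>\<^bsub>G_fin G \<Gamma>\<^esub>) \<in> h ` carrier G"
    proof (rule hom_free_Abelian_group_in_subgroup [OF T.is_group inf_part_hom K _ p(2)])
      fix C
      assume C: "C \<in> InfC"
      then obtain x where "x \<in> S" "C = cls x"
        using inf_gen_classes_iff by blast
      then show "(frag_of C, \<one>\<^bsub>G_fin G \<Gamma>\<^esub>) \<in> h ` carrier G"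
        using std_img std_gen_inf [OF C] by metis
    qed
    moreover have "(0, pi_bar G \<Gamma> y) \<in> h ` carrier G"
    proof (rule hom_free_Abelian_group_in_subgroup [OF T.is_group fin_part_hom K _ y(1)])
      fix C
      assume C: "C \<in> FinC"
      then obtain x where "x \<in> S" "C = cls x"
        using fin_gen_classes_iff by blast
      then show "(0, pi_bar G \<Gamma> (frag_of C)) \<in> h ` carrier G"
        using std_img std_gen_fin [OF C] by metis
    qed
    ultimately have "(z, \<one>\<^bsub>G_fin G \<Gamma>\<^esub>) \<otimes>\<^bsub>abel_target G \<Gamma>\<^esub> (0, t) \<in> h ` carrier G"
      using subgroup.m_closed [OF K] y(2) by metis
    then show "p \<in> h ` carrier G"
      using p by (simp add: abel_target_def)
  qed
qed

lemma coset_hom: "(\<lambda>g. derived G (carrier G) #> g) \<in> hom G (G Mod derived G (carrier G))"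
  using normal.r_coset_hom_Mod [OF derived_self_is_normal] .

text \<open>To show that an element dying in the target lies in the derived subgroup, evaluate a
  word for it in the free abelian group \<open>?E\<close> on the classes. This group maps by
  \<open>r\<close> to the target and by \<open>q\<close> to the abelianisation, and on generators
  these maps reproduce \<open>h\<close> and the coset map. A word killed by \<open>h\<close> gives
  \<open>(0, y)\<close> with \<open>y\<close> in the image of \<open>scale_frag\<close>, and
  \<open>q\<close> kills such pairs.\<close>

lemma abel_hom_kernel:
  assumes h: "h \<in> hom G (abel_target G \<Gamma>)" "\<And>x. x \<in> S \<Longrightarrow> h (\<iota> x) = std_gen G \<Gamma> (cls x)"
  shows "kernel G (abel_target G \<Gamma>) h = derived G (carrier G)"
proof
  let ?A = "G Mod derived G (carrier G)"
  interpret T: comm_group "abel_target G \<Gamma>"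
    by (rule comm_group_abel_target)
  interpret fin: comm_group "G_fin G \<Gamma>"
    by (rule comm_group_G_fin)
  interpret h: group_hom G "abel_target G \<Gamma>" h
    using h(1) by (simp add: group_hom_def group_hom_axioms_def T.is_group is_group)
  interpret A: comm_group ?A
    by (rule derived_quot_is_comm_group)
  have "h ` derived G (carrier G) = {\<one>\<^bsub>abel_target G \<Gamma>\<^esub>}"
    using h.derived_img [of "carrier G"] T.derived_eq_singleton [of "h ` carrier G"] hom_carrier [OF h(1)]
    by simp
  then show "derived G (carrier G) \<subseteq> kernel G (abel_target G \<Gamma>) h"
    using derived_in_carrier [of "carrier G"] by (auto simp: kernel_def)

  let ?coset = "\<lambda>g. derived G (carrier G) #> g"
  have coset_closed: "?coset g \<in> carrier ?A" if "g \<in> carrier G" for g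
    using hom_in_carrier [OF coset_hom that] .
  \<comment> \<open>\<open>q\<close> has to be defined on classes, so each class gets a generator;
    \<open>coset_rep\<close> shows that the coset does not depend on which.\<close>
  define rep where "rep C = (SOME x. x \<in> S \<and> C = cls x)" for C
  have rep: "rep (cls x) \<in> S \<and> cls x = cls (rep (cls x))" if "x \<in> S" for x
    unfolding rep_def by (rule someI [of _ x]) (simp add: that)
  have coset_rep: "?coset (\<iota> (rep (cls x))) = ?coset (\<iota> x)" if "x \<in> S" for x
  proof -
    have "\<iota> x \<in> cls (rep (cls x))"
      using rep [OF that] conj_class_self [OF gen_closed [OF that]] by simp
    then obtain b where "b \<in> carrier G" "\<iota> x = conj_by G (\<iota> (rep (cls x))) b"
      by (auto simp: conj_class_def)
    then show ?thesis
      using hom_conj_by [OF is_group A.comm_group_axioms coset_hom, of "\<iota> (rep (cls x))" b] rep [OF that]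
      by simp
  qed
  have rep_closed: "?coset (\<iota> (rep C)) \<in> carrier ?A" if "C \<in> gen_classes G \<Gamma>" for C
    using that rep coset_closed gen_closed by (auto simp: gen_classes_iff)
  have "(\<lambda>C. ?coset (\<iota> (rep C))) ` InfC \<subseteq> carrier ?A"
    using rep_closed by (auto simp: inf_gen_classes_def)
  then obtain q1 where q1: "q1 \<in> hom (free_Abelian_group InfC) ?A"
      "\<And>C. C \<in> InfC \<Longrightarrow> q1 (frag_of C) = ?coset (\<iota> (rep C))"
    using A.free_Abelian_group_universal by metis
  have "(\<lambda>C. ?coset (\<iota> (rep C))) ` FinC \<subseteq> carrier ?A"
    using rep_closed by (auto simp: fin_gen_classes_def)
  then obtain q2 where q2: "q2 \<in> hom Z_fin ?A"
      "\<And>C. C \<in> FinC \<Longrightarrow> q2 (frag_of C) = ?coset (\<iota> (rep C))"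
    using A.free_Abelian_group_universal by metis
  let ?E = "free_Abelian_group InfC \<times>\<times> Z_fin"
  have E: "group ?E"
    by (rule DirProd_group) simp_all
  define \<epsilon> where "\<epsilon> x = (if cls x \<in> InfC then (frag_of (cls x), 0) else (0, frag_of (cls x)))" for x
  have \<epsilon>_closed: "\<epsilon> \<in> S \<rightarrow> carrier ?E"
    using cls_cases unfolding \<epsilon>_def by fastforce
  define q where "q p = q1 (fst p) \<otimes>\<^bsub>?A\<^esub> q2 (snd p)" for p
  have q_hom: "q \<in> hom ?E ?A"
    unfolding q_def by (rule A.hom_DirProd_mult [OF q1(1) q2(1)])
  have one_q1: "q1 0 = \<one>\<^bsub>?A\<^esub>"
    using hom_one [OF q1(1)] by (simp add: A.is_group)
  have one_q2: "q2 0 = \<one>\<^bsub>?A\<^esub>"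
    using hom_one [OF q2(1)] by (simp add: A.is_group)
  have q_\<epsilon>: "q (\<epsilon> x) = ?coset (\<iota> x)" if "x \<in> S" for x
  proof (cases "cls x \<in> InfC")
    case True
    then have "q (\<epsilon> x) = ?coset (\<iota> x) \<otimes>\<^bsub>?A\<^esub> \<one>\<^bsub>?A\<^esub>"
      unfolding q_def \<epsilon>_def using q1(2) [OF True] coset_rep [OF that] one_q2
      by (simp del: one_FactGroup mult_FactGroup)
    then show ?thesis
      using A.r_one [OF coset_closed [OF gen_closed [OF that]]] by argo
  next
    case False
    then have "cls x \<in> FinC"
      using cls_cases [OF that] by blast
    then have "q (\<epsilon> x) = \<one>\<^bsub>?A\<^esub> \<otimes>\<^bsub>?A\<^esub> ?coset (\<iota> x)"
      unfolding q_def \<epsilon>_def using False q2(2) coset_rep [OF that] one_q1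
      by (simp del: one_FactGroup mult_FactGroup)
    then show ?thesis
      using A.l_one [OF coset_closed [OF gen_closed [OF that]]] by argo
  qed
  define r where "r = (\<lambda>(z, y). (z :: 'a set \<Rightarrow>\<^sub>0 int, pi_bar G \<Gamma> y))"
  have r_hom: "r \<in> hom ?E (abel_target G \<Gamma>)"
  proof -
    have "(\<lambda>z. z) \<in> hom (free_Abelian_group InfC) (free_Abelian_group InfC)"
      by (simp add: hom_def)
    then show ?thesis
      unfolding r_def abel_target_def using pi_bar_hom by (simp add: hom_paired2)
  qed
  have pi_bar_0: "pi_bar G \<Gamma> 0 = \<one>\<^bsub>G_fin G \<Gamma>\<^esub>"
    using hom_one [OF pi_bar_hom] by (simp add: fin.is_group)
  have r_\<epsilon>: "r (\<epsilon> x) = std_gen G \<Gamma> (cls x)" if "x \<in> S" for x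
    using cls_cases [OF that] by (auto simp: r_def \<epsilon>_def std_gen_inf std_gen_fin pi_bar_0)
  \<comment> \<open>Besides commutativity this is the only relation the abelianisation has to
    satisfy here: it holds because \<open>\<iota> x\<close> raised to its class order is already
    trivial in \<open>G\<close>.\<close>
  have q2_scale: "q2 (scale_frag (class_order G) u) = \<one>\<^bsub>?A\<^esub>" if "Poly_Mapping.keys u \<subseteq> FinC" for u
  proof -
    have hom1: "q2 \<circ> scale_frag (class_order G) \<in> hom Z_fin ?A"
      using Group.hom_compose [OF hom_scale_frag q2(1)] .
    have hom2: "(\<lambda>_. \<one>\<^bsub>?A\<^esub>) \<in> hom Z_fin ?A"
      by (simp add: hom_def del: one_FactGroup mult_FactGroup)
    have "(q2 \<circ> scale_frag (class_order G)) u = (\<lambda>_. \<one>\<^bsub>?A\<^esub>) u"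
    proof (rule hom_free_Abelian_group_eqI [OF A.is_group hom1 hom2 _ that])
      fix C
      assume C: "C \<in> FinC"
      then obtain x where x: "x \<in> S" "C = cls x"
        using fin_gen_classes_iff by blast
      let ?k = "class_order G C"
      have "(q2 \<circ> scale_frag (class_order G)) (frag_of C) = q2 (frag_of C [^]\<^bsub>Z_fin\<^esub> ?k)"
        by (simp add: scale_frag_of)
      also have "\<dots> = q2 (frag_of C) [^]\<^bsub>?A\<^esub> ?k"
        using C by (intro hom_nat_pow [OF q2(1)]) (simp_all add: A.is_group)
      also have "q2 (frag_of C) = ?coset (\<iota> x)"
        using q2(2) [OF C] coset_rep [OF x(1)] x(2) by simp
      also have "?coset (\<iota> x) [^]\<^bsub>?A\<^esub> ?k = ?coset (\<iota> x [^] ?k)"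
        using hom_nat_pow [OF coset_hom gen_closed [OF x(1)] is_group A.is_group, of ?k] by simp
      also have "\<iota> x [^] ?k = \<one>"
        using x class_order_cls [OF x(1)] by simp
      also have "?coset \<one> = \<one>\<^bsub>?A\<^esub>"
        using hom_one [OF coset_hom is_group A.is_group] .
      finally show "(q2 \<circ> scale_frag (class_order G)) (frag_of C) = \<one>\<^bsub>?A\<^esub>" .
    qed
    then show ?thesis
      by simp
  qed
  show "kernel G (abel_target G \<Gamma>) h \<subseteq> derived G (carrier G)"
  proof
    fix g
    assume "g \<in> kernel G (abel_target G \<Gamma>) h"
    then have g: "g \<in> carrier G" "h g = \<one>\<^bsub>abel_target G \<Gamma>\<^esub>"
      by (auto simp: kernel_def)
    obtain w where w: "w \<in> words S" "g = eval_word G \<iota> w"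
      using eval_gens_surj [OF g(1)] by blast
    \<comment> \<open>\<open>z\<close> and \<open>y\<close> record the exponent sums of
      \<open>w\<close>, class by class.\<close>
    obtain z y where zy: "eval_word ?E \<epsilon> w = (z, y)"
      by (cases "eval_word ?E \<epsilon> w")
    have "eval_word ?E \<epsilon> w \<in> carrier ?E"
      using group.eval_word_closed [OF E \<epsilon>_closed w(1)] .
    then have y: "y \<in> carrier Z_fin"
      by (simp add: zy)
    have "r (z, y) = eval_word (abel_target G \<Gamma>) (\<lambda>x. r (\<epsilon> x)) w"
      using hom_eval_word [OF E T.is_group r_hom \<epsilon>_closed w(1)] by (simp add: zy)
    also have "\<dots> = eval_word (abel_target G \<Gamma>) (\<lambda>x. h (\<iota> x)) w"
      using r_\<epsilon> h(2) by (intro eval_word_cong [OF w(1)]) simp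
    also have "\<dots> = h g"
      using hom_eval_word [OF is_group T.is_group h(1) gens_closed w(1)] w(2) by simp
    finally have "z = 0" "pi_bar G \<Gamma> y = \<one>\<^bsub>G_fin G \<Gamma>\<^esub>"
      using g(2) by (simp_all add: r_def abel_target_def)
    then obtain u where u: "Poly_Mapping.keys u \<subseteq> FinC" "y = scale_frag (class_order G) u"
      using pi_bar_kernel [OF y] by auto
    have "?coset g = eval_word ?A (\<lambda>x. ?coset (\<iota> x)) w"
      using hom_eval_word [OF is_group A.is_group coset_hom gens_closed w(1)] w(2) by simp
    also have "\<dots> = eval_word ?A (\<lambda>x. q (\<epsilon> x)) w"
      using q_\<epsilon> by (intro eval_word_cong [OF w(1)]) simp
    also have "\<dots> = q (z, y)"
      using hom_eval_word [OF E A.is_group q_hom \<epsilon>_closed w(1)] by (simp add: zy)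
    also have "\<dots> = \<one>\<^bsub>?A\<^esub>"
      using q2_scale [OF u(1)] A.l_one [OF A.one_closed]
      by (simp add: q_def \<open>z = 0\<close> u(2) one_q1 del: one_FactGroup mult_FactGroup)
    finally have "?coset g = derived G (carrier G)"
      by simp
    then show "g \<in> derived G (carrier G)"
      using rcos_self [OF g(1) derived_is_subgroup [of "carrier G"]] by simp
  qed
qed

text \<open>Existence is the first isomorphism theorem applied to \<open>h\<close>, whose kernel is
  the derived subgroup. Uniqueness holds since the cosets of generators determine a homomorphism and
  extensionality settles the rest.\<close>

lemma abel_iso_correct:
  shows "abel_iso G \<Gamma> \<in> iso (G Mod derived G (carrier G)) (abel_target G \<Gamma>)"
    and "\<And>x. x \<in> S \<Longrightarrow> abel_iso G \<Gamma> (derived G (carrier G) #> \<iota> x) = std_gen G \<Gamma> (cls x)"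
proof -
  let ?A = "G Mod derived G (carrier G)" and ?T = "abel_target G \<Gamma>"
  let ?coset = "\<lambda>g. derived G (carrier G) #> g"
  interpret T: comm_group ?T
    by (rule comm_group_abel_target)
  interpret A: comm_group ?A
    by (rule derived_quot_is_comm_group)
  obtain h where h: "h \<in> hom G ?T" "\<And>x. x \<in> S \<Longrightarrow> h (\<iota> x) = std_gen G \<Gamma> (cls x)"
    using abel_hom_exists by blast
  interpret h: group_hom G ?T h
    using h(1) by (simp add: group_hom_def group_hom_axioms_def T.is_group is_group)
  \<comment> \<open>The map of the first isomorphism theorem sends a coset to the single element of
    its image; the restriction makes it extensional, as the description demands.\<close>
  define \<Psi> where "\<Psi> = restrict (\<lambda>K. the_elem (h ` K)) (carrier ?A)"
  let ?Q = "\<lambda>\<Phi>. \<Phi> \<in> extensional (carrier ?A) \<and> \<Phi> \<in> iso ?A ?T \<and>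
             (\<forall>a\<in>\<Gamma>. \<Phi> (?coset a) = std_gen G \<Gamma> (conj_class G a))"
  have kernel: "kernel G ?T h = derived G (carrier G)"
    using abel_hom_kernel [OF h] .
  have iso: "(\<lambda>K. the_elem (h ` K)) \<in> iso ?A ?T"
    using h.FactGroup_iso_set [OF abel_hom_surj [OF h]] by (simp add: kernel)
  have "\<Psi> \<in> hom ?A ?T"
    by (rule A.hom_restrict [of "\<lambda>K. the_elem (h ` K)"]) (use iso in \<open>simp_all add: iso_def \<Psi>_def\<close>)
  moreover have "bij_betw \<Psi> (carrier ?A) (carrier ?T)"
    by (rule bij_betw_cong [THEN iffD1, of _ "\<lambda>K. the_elem (h ` K)"])
      (use iso in \<open>simp_all add: iso_def \<Psi>_def\<close>)
  ultimately have \<Psi>_iso: "\<Psi> \<in> iso ?A ?T"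
    by (simp add: iso_def)
  have \<Psi>_coset: "\<Psi> (?coset g) = h g" if "g \<in> carrier G" for g
  proof -
    have "h ` ?coset g = {h g}"
    proof -
      have "h k = h g" if k: "k \<in> ?coset g" for k
      proof -
        obtain d where d: "d \<in> derived G (carrier G)" "k = d \<otimes> g"
          using k by (auto simp: r_coset_def)
        then have "d \<in> carrier G" "h d = \<one>\<^bsub>?T\<^esub>"
          unfolding kernel [symmetric] kernel_def by auto
        then show ?thesis
          using d(2) \<open>g \<in> carrier G\<close> by simp
      qed
      moreover have "g \<in> ?coset g"
        using rcos_self [OF that derived_is_subgroup [of "carrier G"]] by simp
      ultimately show ?thesis
        by blast
    qed
    then show ?thesis
      using hom_in_carrier [OF coset_hom that] by (simp add: \<Psi>_def)
  qed
  have "?Q \<Psi>"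
    using \<Psi>_iso \<Psi>_coset h(2) by (auto simp: \<Psi>_def gens)
  moreover have "\<Phi> = \<Psi>" if \<Phi>: "?Q \<Phi>" for \<Phi>
  proof (rule extensionalityI)
    show "\<Phi> \<in> extensional (carrier ?A)" "\<Psi> \<in> extensional (carrier ?A)"
      using \<Phi> by (simp_all add: \<Psi>_def)
    fix K
    assume "K \<in> carrier ?A"
    then obtain g where g: "g \<in> carrier G" "K = ?coset g"
      by (auto simp: carrier_FactGroup)
    have \<Phi>_hom: "\<Phi> \<in> hom ?A ?T"
      using \<Phi> by (simp add: iso_def)
    have "(\<Phi> \<circ> ?coset) g = h g"
    proof (rule hom_eqI_gens [OF T.is_group Group.hom_compose [OF coset_hom \<Phi>_hom] h(1) _ g(1)])
      fix x
      assume "x \<in> S"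
      then show "(\<Phi> \<circ> ?coset) (\<iota> x) = h (\<iota> x)"
        using \<Phi> h(2) by (simp add: gens)
    qed
    then show "\<Phi> K = \<Psi> K"
      using g \<Psi>_coset by simp
  qed
  ultimately have Q: "?Q (abel_iso G \<Gamma>)"
    unfolding abel_iso_def by (rule theI)
  then show "abel_iso G \<Gamma> \<in> iso ?A ?T"
    by blast
  show "abel_iso G \<Gamma> (?coset (\<iota> x)) = std_gen G \<Gamma> (cls x)" if "x \<in> S" for x
    using Q that by (simp add: gens)
qed

lemma Ab_fin_hom: "Ab_fin G \<Gamma> \<in> hom G (G_fin G \<Gamma>)"
proof -
  have "abel_iso G \<Gamma> \<in> hom (G Mod derived G (carrier G)) (abel_target G \<Gamma>)"
    using abel_iso_correct(1) by (simp add: iso_def)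
  from Group.hom_compose [OF coset_hom this] have "abel_map G \<Gamma> \<in> hom G (abel_target G \<Gamma>)"
    by (simp add: abel_map_def [abs_def] o_def)
  then show ?thesis
    by (simp add: abel_target_def hom_pairwise Ab_fin_def [abs_def] o_def)
qed

text \<open>Phrased through \<open>pi_bar\<close> to match the values of \<open>dehn_Ab_fin\<close>
  on the \<open>e a\<close>. A generator of infinite order contributes to the free summand only,
  hence the argument \<open>0\<close>.\<close>

lemma Ab_fin_gen:
  assumes "x \<in> S"
  shows "Ab_fin G \<Gamma> (\<iota> x) = pi_bar G \<Gamma> (if cls x \<in> FinC then frag_of (cls x) else 0)"
proof -
  interpret fin: comm_group "G_fin G \<Gamma>"
    by (rule comm_group_G_fin)
  have "pi_bar G \<Gamma> 0 = \<one>\<^bsub>G_fin G \<Gamma>\<^esub>"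
    using hom_one [OF pi_bar_hom] by (simp add: fin.is_group)
  then show ?thesis
    using assms cls_cases [OF assms] abel_iso_correct(2) [OF assms]
    by (auto simp: Ab_fin_def abel_map_def std_gen_fin std_gen_inf FinC_not_InfC)
qed

section \<open>The structure group of the Dehn quandle\<close>

abbreviation Q :: "'a set" where
  "Q \<equiv> dehn_quandle G \<Gamma>"

abbreviation D :: "'a word set monoid" where
  "D \<equiv> dehn_group G \<Gamma>"

abbreviation e :: "'a \<Rightarrow> 'a word set" where
  "e \<equiv> dehn_gen G \<Gamma>"

lemma Q_iff: "a \<in> Q \<longleftrightarrow> (\<exists>x\<in>S. a \<in> cls x)"
  by (simp add: dehn_quandle_def gens)

lemma Q_closed: "a \<in> Q \<Longrightarrow> a \<in> carrier G"
  using conj_class_subset [OF gen_closed] by (auto simp: Q_iff)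

lemma gen_in_Q: "x \<in> S \<Longrightarrow> \<iota> x \<in> Q"
  using conj_class_self [OF gen_closed] by (auto simp: Q_iff)

lemma Q_cls: "a \<in> Q \<Longrightarrow> \<exists>x\<in>S. conj_class G a = cls x"
proof -
  assume "a \<in> Q"
  then obtain x g where "x \<in> S" "g \<in> carrier G" "a = conj_by G (\<iota> x) g"
    unfolding Q_iff by (auto simp: conj_class_def)
  then show ?thesis
    using conj_class_conj_by [OF gen_closed] by blast
qed

lemma conj_by_Q:
  assumes "a \<in> Q" "b \<in> carrier G"
  shows "conj_by G a b \<in> Q"
proof -
  obtain x where x: "x \<in> S" "conj_class G a = cls x"
    using Q_cls [OF assms(1)] by blast
  then have "conj_by G a b \<in> cls x"
    using assms by (auto simp: conj_class_def [of G a])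
  then show ?thesis
    using x(1) Q_iff by blast
qed

sublocale D: group D
  unfolding dehn_group_def by (rule group_presented_group)

lemma e_closed: "a \<in> Q \<Longrightarrow> e a \<in> carrier D"
  by (simp add: dehn_gen_def dehn_group_def)

lemma conj_by_e:
  assumes "a \<in> Q" "b \<in> Q"
  shows "conj_by D (e a) (e b) = e (conj_by G a b)"
proof -
  have ab: "conj_by G a b \<in> Q"
    using assms by (simp add: conj_by_Q Q_closed)
  have "pres_cong Q (dehn_relations G \<Gamma>) [Gen a, Gen b] [Gen b, Gen (conj_by G a b)]"
    using assms ab by (intro pres_cong.relation) (auto simp: dehn_relations_def)
  then have "e a \<otimes>\<^bsub>D\<^esub> e b = e b \<otimes>\<^bsub>D\<^esub> e (conj_by G a b)"
    using assms ab by (simp add: dehn_gen_def dehn_group_def mult_presented_group word_class_eq_iff)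
  then show ?thesis
    using assms ab by (simp add: D.conj_by_eq_iff e_closed)
qed

lemma dehn_relations_cases:
  assumes "(u, v) \<in> dehn_relations G \<Gamma>"
  obtains a b where "a \<in> Q" "b \<in> Q" "u = [Gen a, Gen b]" "v = [Gen b, Gen (conj_by G a b)]"
  using assms by (auto simp: dehn_relations_def)

lemma dehn_pi_hom: "dehn_pi G \<Gamma> \<in> hom D G"
  and dehn_pi_e: "a \<in> Q \<Longrightarrow> dehn_pi G \<Gamma> (e a) = a"
proof -
  have f: "(\<lambda>a. a) \<in> Q \<rightarrow> carrier G"
    using Q_closed by blast
  have rel: "eval_word G (\<lambda>a. a) u = eval_word G (\<lambda>a. a) v"
    if "(u, v) \<in> dehn_relations G \<Gamma>" "u \<in> words Q" "v \<in> words Q" for u v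
  proof -
    obtain a b where ab: "a \<in> Q" "b \<in> Q" "u = [Gen a, Gen b]" "v = [Gen b, Gen (conj_by G a b)]"
      using dehn_relations_cases [OF \<open>(u, v) \<in> _\<close>] by blast
    then show ?thesis
      using Q_closed [OF ab(1)] Q_closed [OF ab(2)] conj_by_eq_iff [of a b "conj_by G a b"] by simp
  qed
  have eq: "dehn_pi G \<Gamma> = hom_on_gens (presented_group Q (dehn_relations G \<Gamma>)) G Q
      (\<lambda>x. word_class Q (dehn_relations G \<Gamma>) [Gen x]) (\<lambda>a. a)"
    by (simp add: dehn_pi_def dehn_group_def dehn_gen_def [abs_def])
  show "dehn_pi G \<Gamma> \<in> hom D G"
    unfolding eq dehn_group_def by (rule hom_on_gens_presented_group(1) [OF is_group f rel])
  show "dehn_pi G \<Gamma> (e a) = a" if "a \<in> Q"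
    unfolding eq dehn_gen_def by (rule hom_on_gens_presented_group(2) [OF is_group f rel that])
qed

abbreviation frag_class :: "'a \<Rightarrow> 'a set \<Rightarrow>\<^sub>0 int" where
  "frag_class a \<equiv> if conj_class G a \<in> FinC then frag_of (conj_class G a) else 0"

text \<open>The relations are respected because \<open>a\<close> and \<open>conj_by G a b\<close>
  have the same class and \<open>Z_fin\<close> is commutative.\<close>

lemma dehn_Ab_fin_hom: "dehn_Ab_fin G \<Gamma> \<in> hom D Z_fin"
  and dehn_Ab_fin_e: "a \<in> Q \<Longrightarrow> dehn_Ab_fin G \<Gamma> (e a) = frag_class a"
proof -
  let ?f = "\<lambda>a. frag_class a"
  have f: "?f \<in> Q \<rightarrow> carrier Z_fin"
    by auto
  have rel: "eval_word Z_fin ?f u = eval_word Z_fin ?f v"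
    if "(u, v) \<in> dehn_relations G \<Gamma>" "u \<in> words Q" "v \<in> words Q" for u v
  proof -
    obtain a b where ab: "a \<in> Q" "b \<in> Q" "u = [Gen a, Gen b]" "v = [Gen b, Gen (conj_by G a b)]"
      using dehn_relations_cases [OF \<open>(u, v) \<in> _\<close>] by blast
    then show ?thesis
      using conj_class_conj_by [OF Q_closed [OF ab(1)] Q_closed [OF ab(2)]] by (simp add: add.commute)
  qed
  have eq: "dehn_Ab_fin G \<Gamma> = hom_on_gens (presented_group Q (dehn_relations G \<Gamma>)) Z_fin Q
      (\<lambda>x. word_class Q (dehn_relations G \<Gamma>) [Gen x]) ?f"
    by (simp add: dehn_Ab_fin_def dehn_group_def dehn_gen_def [abs_def])
  show "dehn_Ab_fin G \<Gamma> \<in> hom D Z_fin"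
    unfolding eq dehn_group_def by (rule hom_on_gens_presented_group(1) [OF group_free_Abelian_group f rel])
  show "dehn_Ab_fin G \<Gamma> (e a) = frag_class a" if "a \<in> Q"
    unfolding eq dehn_gen_def by (rule hom_on_gens_presented_group(2) [OF group_free_Abelian_group f rel that])
qed

sublocale pi: group_hom D G "dehn_pi G \<Gamma>"
  by unfold_locales (rule dehn_pi_hom)

lemma e_funcset: "e \<in> Q \<rightarrow> carrier D"
  using e_closed by blast

lemma D_words:
  assumes "y \<in> carrier D"
  obtains w where "w \<in> words Q" "y = eval_word D e w"
proof -
  obtain w where w: "w \<in> words Q" "y = word_class Q (dehn_relations G \<Gamma>) w"
    using assms unfolding dehn_group_def carrier_presented_group by blast
  then have "y = eval_word D e w"
    unfolding dehn_group_def dehn_gen_def [abs_def] by (simp add: eval_word_presented_group)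
  then show ?thesis
    using w(1) that by blast
qed

text \<open>Letters are peeled off from the left, and each one moves \<open>a\<close> within its
  class; therefore the induction keeps \<open>a\<close> arbitrary.\<close>

lemma conj_by_D_words:
  assumes "w \<in> words Q" "a \<in> Q"
  shows "conj_by D (e a) (eval_word D e w) = e (conj_by G a (dehn_pi G \<Gamma> (eval_word D e w)))"
  using assms
proof (induction arbitrary: a rule: words_induct)
  case Nil
  then show ?case
    by (simp add: e_closed Q_closed)
next
  case (Gen b w)
  have y: "eval_word D e w \<in> carrier D"
    by (rule D.eval_word_closed [OF e_funcset]) fact
  have ab: "conj_by G a b \<in> Q"
    using Gen by (simp add: conj_by_Q Q_closed)
  have "conj_by D (e a) (eval_word D e (Gen b # w)) = conj_by D (conj_by D (e a) (e b)) (eval_word D e w)"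
    using Gen y by (simp add: D.conj_by_mult e_closed)
  also have "\<dots> = e (conj_by G (conj_by G a b) (dehn_pi G \<Gamma> (eval_word D e w)))"
    using Gen ab by (simp add: conj_by_e)
  also have "\<dots> = e (conj_by G a (dehn_pi G \<Gamma> (eval_word D e (Gen b # w))))"
    using Gen y by (simp add: conj_by_mult Q_closed e_closed dehn_pi_e)
  finally show ?case .
next
  case (GenInv b w)
  have y: "eval_word D e w \<in> carrier D"
    by (rule D.eval_word_closed [OF e_funcset]) fact
  \<comment> \<open>\<open>conj_by_e\<close> handles conjugation by \<open>e b\<close> only. Since
    \<open>b\<close> carries \<open>?a'\<close> to \<open>a\<close>, conjugation by the inverse of
    \<open>e b\<close> must take \<open>e a\<close> back to \<open>e ?a'\<close>.\<close>
  let ?a' = "conj_by G a (inv b)"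
  have c: "a \<in> carrier G" "b \<in> carrier G"
    using GenInv Q_closed by auto
  have a': "?a' \<in> Q"
    using GenInv c by (simp add: conj_by_Q)
  have "conj_by D (e ?a') (e b) = e a"
    using conj_by_e [OF a' GenInv(1)] c by (simp add: conj_by_mult)
  then have "conj_by D (e a) (inv\<^bsub>D\<^esub> e b) = e ?a'"
    using D.conj_by_mult [of "e ?a'" "e b" "inv\<^bsub>D\<^esub> e b"] a' GenInv(1) by (simp add: e_closed)
  then have "conj_by D (e a) (eval_word D e (GenInv b # w)) = conj_by D (e ?a') (eval_word D e w)"
    using GenInv y D.conj_by_mult [of "e a" "inv\<^bsub>D\<^esub> e b" "eval_word D e w"] by (simp add: e_closed)
  also have "\<dots> = e (conj_by G ?a' (dehn_pi G \<Gamma> (eval_word D e w)))"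
    using GenInv a' by simp
  also have "\<dots> = e (conj_by G a (dehn_pi G \<Gamma> (eval_word D e (GenInv b # w))))"
    using GenInv(1) c y by (simp add: conj_by_mult e_closed dehn_pi_e)
  finally show ?case .
qed

lemma conj_by_D:
  assumes "a \<in> Q" "y \<in> carrier D"
  shows "conj_by D (e a) y = e (conj_by G a (dehn_pi G \<Gamma> y))"
proof -
  obtain w where "w \<in> words Q" "y = eval_word D e w"
    using D_words [OF assms(2)] .
  then show ?thesis
    using conj_by_D_words assms(1) by blast
qed

abbreviation e_gen :: "'x \<Rightarrow> 'a word set" where
  "e_gen x \<equiv> e (\<iota> x)"

lemma e_gen_funcset: "e_gen \<in> S \<rightarrow> carrier D"
  using e_closed gen_in_Q by blast

lemma eval_e_gen_closed: "w \<in> words S \<Longrightarrow> eval_word D e_gen w \<in> carrier D"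
  by (rule D.eval_word_closed [OF e_gen_funcset])

lemma dehn_pi_eval:
  assumes "w \<in> words S"
  shows "dehn_pi G \<Gamma> (eval_word D e_gen w) = eval_word G \<iota> w"
proof -
  have "dehn_pi G \<Gamma> (eval_word D e_gen w) = eval_word G (\<lambda>x. dehn_pi G \<Gamma> (e_gen x)) w"
    by (rule hom_eval_word [OF D.is_group is_group dehn_pi_hom e_gen_funcset assms])
  also have "\<dots> = eval_word G \<iota> w"
    using dehn_pi_e gen_in_Q by (intro eval_word_cong [OF assms]) simp
  finally show ?thesis .
qed

lemma dehn_pi_surj:
  assumes "g \<in> carrier G"
  obtains y where "y \<in> carrier D" "dehn_pi G \<Gamma> y = g"
proof -
  obtain w where "w \<in> words S" "g = eval_word G \<iota> w"
    using eval_gens_surj [OF assms] .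
  then show ?thesis
    using that [of "eval_word D e_gen w"] dehn_pi_eval eval_e_gen_closed by blast
qed

text \<open>Any \<open>a \<in> Q\<close> is some \<open>\<iota> x\<close> conjugated by an element
  \<open>g\<close> of \<open>G\<close>. A word over \<open>S\<close> for \<open>g\<close>, read in
  \<open>D\<close>, is a lift of \<open>g\<close>, and conjugating \<open>e_gen x\<close> by it
  yields \<open>e a\<close>. Thus elements of \<open>D\<close> and of \<open>G\<close> can be
  compared through the same words.\<close>

lemma D_gens:
  assumes "y \<in> carrier D"
  obtains w where "w \<in> words S" "y = eval_word D e_gen w"
proof -
  let ?K = "eval_word D e_gen ` words S"
  have K: "subgroup ?K D"
    by (rule D.subgroup_eval_word [OF e_gen_funcset])
  interpret K: subgroup ?K D
    by (rule K)
  have "e a \<in> ?K" if a: "a \<in> Q" for a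
  proof -
    obtain x g where x: "x \<in> S" "g \<in> carrier G" "a = conj_by G (\<iota> x) g"
      using a unfolding Q_iff by (auto simp: conj_class_def)
    obtain v where v: "v \<in> words S" "g = eval_word G \<iota> v"
      using eval_gens_surj [OF x(2)] by blast
    have "e a = conj_by D (e_gen x) (eval_word D e_gen v)"
      using conj_by_D [OF gen_in_Q [OF x(1)] eval_e_gen_closed [OF v(1)]] dehn_pi_eval [OF v(1)] v(2) x(3)
      by simp
    moreover have "e_gen x = eval_word D e_gen [Gen x]"
      using e_closed [OF gen_in_Q [OF x(1)]] by simp
    then have "e_gen x \<in> ?K"
      using x(1) by (metis imageI words_Cons words_Nil)
    ultimately show ?thesis
      using v(1) by (simp add: conj_by_def)
  qed
  then have "e \<in> Q \<rightarrow> ?K"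
    by blast
  moreover obtain w where "w \<in> words Q" "y = eval_word D e w"
    using D_words [OF assms] .
  ultimately have "y \<in> ?K"
    using D.eval_word_in_subgroup [OF K, of e Q w] by blast
  then show ?thesis
    using that by blast
qed

text \<open>The power lies in the kernel of \<open>dehn_pi\<close>, and by \<open>conj_by_D\<close>
  conjugation by such an element fixes every \<open>e b\<close>.\<close>

lemma e_pow_centre:
  assumes "a \<in> Q" "a [^] k = \<one>"
  shows "e a [^]\<^bsub>D\<^esub> (k::nat) \<in> centre D"
proof -
  let ?z = "e a [^]\<^bsub>D\<^esub> k"
  have z: "?z \<in> carrier D"
    using e_closed [OF assms(1)] by simp
  have \<pi>z: "dehn_pi G \<Gamma> ?z = \<one>"
    using assms e_closed [OF assms(1)] dehn_pi_e [OF assms(1)] by (simp add: pi.hom_nat_pow)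
  have "e b \<in> {y \<in> carrier D. ?z \<otimes>\<^bsub>D\<^esub> y = y \<otimes>\<^bsub>D\<^esub> ?z}" if "b \<in> Q" for b
  proof -
    have "conj_by D (e b) ?z = e b"
      using conj_by_D [OF that z] \<pi>z Q_closed [OF that] by simp
    then show ?thesis
      using z e_closed [OF that] by (simp add: D.conj_by_eq_iff)
  qed
  then have e: "e \<in> Q \<rightarrow> {y \<in> carrier D. ?z \<otimes>\<^bsub>D\<^esub> y = y \<otimes>\<^bsub>D\<^esub> ?z}"
    by blast
  have "?z \<otimes>\<^bsub>D\<^esub> y = y \<otimes>\<^bsub>D\<^esub> ?z" if y: "y \<in> carrier D" for y
  proof -
    obtain w where "w \<in> words Q" "y = eval_word D e w"
      using D_words [OF y] .
    then show ?thesis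
      using D.eval_word_in_subgroup [OF D.subgroup_centralizer [OF z] e] by simp
  qed
  then show ?thesis
    using z by (simp add: centre_def)
qed

text \<open>Lifting the conjugating element from \<open>G\<close> to \<open>D\<close> makes the two
  powers conjugate in \<open>D\<close>, and one of them is central.\<close>

lemma e_pow_conj:
  assumes "a \<in> Q" "a [^] k = \<one>" "b \<in> conj_class G a"
  shows "e b [^]\<^bsub>D\<^esub> (k::nat) = e a [^]\<^bsub>D\<^esub> k"
proof -
  obtain g where g: "g \<in> carrier G" "b = conj_by G a g"
    using assms(3) by (auto simp: conj_class_def)
  obtain y where y: "y \<in> carrier D" "dehn_pi G \<Gamma> y = g"
    using dehn_pi_surj [OF g(1)] by blast
  have "e b [^]\<^bsub>D\<^esub> k = conj_by D (e a) y [^]\<^bsub>D\<^esub> k"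
    using conj_by_D [OF assms(1) y(1)] y(2) g(2) by simp
  also have "\<dots> = conj_by D (e a [^]\<^bsub>D\<^esub> k) y"
    using D.conj_by_pow [OF e_closed [OF assms(1)] y(1)] by simp
  also have "\<dots> = e a [^]\<^bsub>D\<^esub> k"
    using e_pow_centre [OF assms(1,2)] y(1) e_closed [OF assms(1)]
    by (simp add: D.conj_by_eq_iff centre_def)
  finally show ?thesis .
qed

section \<open>The pullback\<close>

lemma FinC_pow:
  assumes "C \<in> FinC" "a \<in> C"
  shows "a \<in> Q" "conj_class G a = C" "a [^] class_order G C = \<one>"
proof -
  obtain x where x: "x \<in> S" "C = cls x"
    using assms(1) fin_gen_classes_iff by blast
  show a: "a \<in> Q"
    using assms(2) x Q_iff by blast
  obtain g where g: "g \<in> carrier G" "a = conj_by G (\<iota> x) g"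
    using assms(2) x(2) by (auto simp: conj_class_def)
  show "conj_class G a = C"
    using conj_class_conj_by [OF gen_closed [OF x(1)] g(1)] g(2) x(2) by simp
  have "class_order G C = ord a"
    using class_order_cls [OF x(1)] ord_conj_by [OF gen_closed [OF x(1)] g(1)] g(2) x(2) by simp
  then show "a [^] class_order G C = \<one>"
    using Q_closed [OF a] by simp
qed

text \<open>The basis vector of a class goes to the power at one chosen member;
  \<open>e_pow_conj\<close> extends the formula to all members.\<close>

lemma kappa_exists:
  obtains \<kappa> where "\<kappa> \<in> hom Z_fin D" "\<And>z. z \<in> carrier Z_fin \<Longrightarrow> \<kappa> z \<in> centre D"
    "\<And>C a. \<lbrakk>C \<in> FinC; a \<in> C\<rbrakk> \<Longrightarrow> \<kappa> (frag_of C) = e a [^]\<^bsub>D\<^esub> class_order G C"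
proof -
  let ?Z = "D\<lparr>carrier := centre D\<rparr>"
  interpret Z: comm_group ?Z
    by (rule D.comm_group_centre)
  define rep where "rep C = (SOME a. a \<in> C)" for C :: "'a set"
  have rep: "rep C \<in> C" if C: "C \<in> FinC" for C
  proof -
    obtain x where x: "x \<in> S" "C = cls x"
      using C fin_gen_classes_iff by blast
    then have "\<iota> x \<in> C"
      using conj_class_self [OF gen_closed [OF x(1)]] by simp
    then show ?thesis
      unfolding rep_def by (rule someI)
  qed
  have "(\<lambda>C. e (rep C) [^]\<^bsub>D\<^esub> class_order G C) ` FinC \<subseteq> carrier ?Z"
  proof (rule image_subsetI)
    fix C
    assume "C \<in> FinC"
    then show "e (rep C) [^]\<^bsub>D\<^esub> class_order G C \<in> carrier ?Z"
      using e_pow_centre [OF FinC_pow(1,3)] rep by simp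
  qed
  then obtain \<kappa> where \<kappa>: "\<kappa> \<in> hom Z_fin ?Z"
    "\<And>C. C \<in> FinC \<Longrightarrow> \<kappa> (frag_of C) = e (rep C) [^]\<^bsub>D\<^esub> class_order G C"
    by (rule Z.free_Abelian_group_universal) blast
  have closed: "\<kappa> z \<in> centre D" if "z \<in> carrier Z_fin" for z
    using hom_in_carrier [OF \<kappa>(1) that] by simp
  moreover have "\<kappa> \<in> hom Z_fin D"
  proof (rule homI)
    show "\<kappa> z \<in> carrier D" if "z \<in> carrier Z_fin" for z
      using closed [OF that] by (simp add: centre_def)
    show "\<kappa> (x \<otimes>\<^bsub>Z_fin\<^esub> y) = \<kappa> x \<otimes>\<^bsub>D\<^esub> \<kappa> y" if "x \<in> carrier Z_fin" "y \<in> carrier Z_fin" for x y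
      using hom_mult [OF \<kappa>(1) that] by simp
  qed
  moreover have "\<kappa> (frag_of C) = e a [^]\<^bsub>D\<^esub> class_order G C" if "C \<in> FinC" "a \<in> C" for C a
  proof -
    note r = FinC_pow [OF that(1) rep [OF that(1)]]
    show ?thesis
      using \<kappa>(2) [OF that(1)] e_pow_conj [OF r(1,3), of a] r(2) that(2) by simp
  qed
  ultimately show ?thesis
    using that by blast
qed

text \<open>\<open>D\<close> modulo the central subgroup generated by the powers \<open>e a ^ k\<close> satisfies the
  defining relations of \<open>G\<close>.\<close>

lemma dehn_pi_kernel:
  assumes \<kappa>: "\<kappa> \<in> hom Z_fin D" "\<And>z. z \<in> carrier Z_fin \<Longrightarrow> \<kappa> z \<in> centre D"
    "\<And>C a. \<lbrakk>C \<in> FinC; a \<in> C\<rbrakk> \<Longrightarrow> \<kappa> (frag_of C) = e a [^]\<^bsub>D\<^esub> class_order G C"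
    and y: "y \<in> carrier D" "dehn_pi G \<Gamma> y = \<one>"
  shows "y \<in> \<kappa> ` carrier Z_fin"
proof -
  let ?K = "\<kappa> ` carrier Z_fin"
  interpret \<kappa>: group_hom Z_fin D \<kappa>
    using \<kappa>(1) by (simp add: group_hom_def group_hom_axioms_def D.is_group)
  have K: "subgroup ?K D"
    by (rule \<kappa>.subgroup_img_is_subgroup) (rule \<kappa>.G.subgroup_self)
  have K_closed: "?K \<subseteq> carrier D"
    using hom_carrier [OF \<kappa>(1)] .
  have "?K \<lhd> D"
  proof (rule D.normal_invI [OF K])
    fix g h
    assume g: "g \<in> carrier D" and h: "h \<in> ?K"
    then have "h \<in> centre D"
      using \<kappa>(2) by blast
    then have "g \<otimes>\<^bsub>D\<^esub> h \<otimes>\<^bsub>D\<^esub> inv\<^bsub>D\<^esub> g = h \<otimes>\<^bsub>D\<^esub> g \<otimes>\<^bsub>D\<^esub> inv\<^bsub>D\<^esub> g"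
      using g by (simp add: centre_def)
    also have "\<dots> = h"
      using g h K_closed by (simp add: D.m_assoc subsetD)
    finally show "g \<otimes>\<^bsub>D\<^esub> h \<otimes>\<^bsub>D\<^esub> inv\<^bsub>D\<^esub> g \<in> ?K"
      using h by simp
  qed
  then interpret K: normal ?K D .
  let ?c = "\<lambda>g. ?K #>\<^bsub>D\<^esub> g"
  have c_hom: "?c \<in> hom D (D Mod ?K)"
    by (rule K.r_coset_hom_Mod)
  have Mod: "group (D Mod ?K)"
    by (rule K.factorgroup_is_group)
  have c_eval: "?c (eval_word D e_gen w) = eval_word (D Mod ?K) (\<lambda>x. ?c (e_gen x)) w"
    if "w \<in> words S" for w
    by (rule hom_eval_word [OF D.is_group Mod c_hom e_gen_funcset that])
  have c_closed: "(\<lambda>x. ?c (e_gen x)) \<in> S \<rightarrow> carrier (D Mod ?K)"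
    using hom_in_carrier [OF c_hom] e_gen_funcset by blast
  have c_K: "?c k = ?c \<one>\<^bsub>D\<^esub>" if "k \<in> ?K" for k
    using D.coset_join2 [OF subsetD [OF K_closed that] K that] D.coset_mult_one [OF K_closed] by simp
  have rel: "eval_word (D Mod ?K) (\<lambda>x. ?c (e_gen x)) u = eval_word (D Mod ?K) (\<lambda>x. ?c (e_gen x)) v"
    if uv: "(u, v) \<in> R" "u \<in> words S" "v \<in> words S" for u v
  proof -
    have "?c (eval_word D e_gen u) = ?c (eval_word D e_gen v)"
      using uv(1)
    proof (cases rule: relations_cases)
      case (conj a b d)
      have "\<iota> d = conj_by G (\<iota> a) (\<iota> b)"
        using relation_eval [OF uv(1)] conj by (simp add: conj_by_def m_assoc)
      \<comment> \<open>Conjugation relations hold in \<open>D\<close> itself; it is the power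
        relations that force the passage to the quotient.\<close>
      then have "e_gen d = conj_by D (e_gen a) (e_gen b)"
        using conj_by_e [OF gen_in_Q [OF conj(1)] gen_in_Q [OF conj(2)]] by simp
      then have "eval_word D e_gen u = eval_word D e_gen v"
        using conj e_closed gen_in_Q by (simp add: conj_by_def D.m_assoc)
      then show ?thesis
        by simp
    next
      case (power a k)
      have k: "ord (\<iota> a) = k"
        using power by (intro ord_gen_power [of a a]) auto
      have C: "cls a \<in> FinC"
        using k power by (simp add: cls_fin_iff)
      have "eval_word D e_gen u = e_gen a [^]\<^bsub>D\<^esub> k"
        using power e_closed [OF gen_in_Q [OF power(1)]] by (simp add: D.eval_word_replicate)
      \<comment> \<open>By \<open>ord_gen_power\<close> the exponent of the relation is the class
        order, so this is exactly the power that \<open>\<kappa>\<close> hits.\<close>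
      also have "\<dots> = \<kappa> (frag_of (cls a))"
        using \<kappa>(3) [OF C conj_class_self [OF gen_closed [OF power(1)]]] class_order_cls [OF power(1)] k
        by simp
      finally have "eval_word D e_gen u \<in> ?K"
        using C by simp
      then have "?c (eval_word D e_gen u) = ?c \<one>\<^bsub>D\<^esub>"
        by (rule c_K)
      then show ?thesis
        using power(4) by simp
    qed
    then show ?thesis
      using c_eval uv(2,3) by simp
  qed
  obtain w where w: "w \<in> words S" "y = eval_word D e_gen w"
    using D_gens [OF y(1)] .
  \<comment> \<open>The presentation of \<open>G\<close> makes \<open>w\<close> congruent to the
    empty word. Since the quotient satisfies \<open>R\<close>, this congruence can be evaluated
    there, which puts \<open>y\<close> into \<open>?K\<close>.\<close>
  have "eval_word G \<iota> w = eval_word G \<iota> []"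
    using dehn_pi_eval [OF w(1)] y(2) w(2) by simp
  then have "pres_cong S R w []"
    using eval_gens_eq_iff [OF w(1) words_Nil] by blast
  from pres_cong_eval_word [OF Mod c_closed rel this]
  have "?c y = ?c \<one>\<^bsub>D\<^esub>"
    using c_eval [OF w(1)] c_eval [OF words_Nil] w(2) by simp
  moreover have "?c \<one>\<^bsub>D\<^esub> = ?K"
    by (rule D.coset_mult_one [OF K_closed])
  ultimately show ?thesis
    using D.rcos_self [OF y(1) K] by simp
qed

text \<open>Both sides are homomorphisms on \<open>D\<close>, so by \<open>D_gens\<close> they need
  comparing only at the \<open>e_gen x\<close>, where \<open>Ab_fin_gen\<close> applies.\<close>

lemma Ab_fin_dehn_pi:
  assumes "y \<in> carrier D"
  shows "Ab_fin G \<Gamma> (dehn_pi G \<Gamma> y) = pi_bar G \<Gamma> (dehn_Ab_fin G \<Gamma> y)"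
proof -
  interpret fin: comm_group "G_fin G \<Gamma>"
    by (rule comm_group_G_fin)
  have hom1: "Ab_fin G \<Gamma> \<circ> dehn_pi G \<Gamma> \<in> hom D (G_fin G \<Gamma>)"
    by (rule Group.hom_compose [OF dehn_pi_hom Ab_fin_hom])
  have hom2: "pi_bar G \<Gamma> \<circ> dehn_Ab_fin G \<Gamma> \<in> hom D (G_fin G \<Gamma>)"
    by (rule Group.hom_compose [OF dehn_Ab_fin_hom pi_bar_hom])
  obtain w where w: "w \<in> words S" "y = eval_word D e_gen w"
    using D_gens [OF assms] .
  have "(Ab_fin G \<Gamma> \<circ> dehn_pi G \<Gamma>) y = eval_word (G_fin G \<Gamma>) (\<lambda>x. (Ab_fin G \<Gamma> \<circ> dehn_pi G \<Gamma>) (e_gen x)) w"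
    unfolding w(2) by (rule hom_eval_word [OF D.is_group fin.is_group hom1 e_gen_funcset w(1)])
  also have "\<dots> = eval_word (G_fin G \<Gamma>) (\<lambda>x. (pi_bar G \<Gamma> \<circ> dehn_Ab_fin G \<Gamma>) (e_gen x)) w"
    using Ab_fin_gen dehn_pi_e [OF gen_in_Q] dehn_Ab_fin_e [OF gen_in_Q]
    by (intro eval_word_cong [OF w(1)]) simp
  also have "\<dots> = (pi_bar G \<Gamma> \<circ> dehn_Ab_fin G \<Gamma>) y"
    unfolding w(2) by (rule hom_eval_word [OF D.is_group fin.is_group hom2 e_gen_funcset w(1), symmetric])
  finally show ?thesis
    by simp
qed

lemma pullback_iso:
  "(\<lambda>y. (dehn_pi G \<Gamma> y, dehn_Ab_fin G \<Gamma> y)) \<in>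
     iso D (pullback_group G Z_fin (Ab_fin G \<Gamma>) (pi_bar G \<Gamma>))"
proof -
  let ?P = "pullback_group G Z_fin (Ab_fin G \<Gamma>) (pi_bar G \<Gamma>)"
  let ?F = "\<lambda>y. (dehn_pi G \<Gamma> y, dehn_Ab_fin G \<Gamma> y)"
  interpret fin: comm_group "G_fin G \<Gamma>"
    by (rule comm_group_G_fin)
  interpret Ab: group_hom D Z_fin "dehn_Ab_fin G \<Gamma>"
    using dehn_Ab_fin_hom by (simp add: group_hom_def group_hom_axioms_def D.is_group)
  interpret bar: group_hom Z_fin "G_fin G \<Gamma>" "pi_bar G \<Gamma>"
    using pi_bar_hom by (simp add: group_hom_def group_hom_axioms_def fin.is_group)
  have carrier_P: "carrier ?P = {(a, x). a \<in> carrier G \<and> x \<in> carrier Z_fin \<and> Ab_fin G \<Gamma> a = pi_bar G \<Gamma> x}"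
    by (simp add: pullback_group_def)
  have hom: "?F \<in> hom D ?P"
  proof (rule homI)
    show "?F y \<in> carrier ?P" if "y \<in> carrier D" for y
      using that Ab.hom_closed [OF that] by (simp add: carrier_P Ab_fin_dehn_pi)
    show "?F (y \<otimes>\<^bsub>D\<^esub> y') = ?F y \<otimes>\<^bsub>?P\<^esub> ?F y'" if "y \<in> carrier D" "y' \<in> carrier D" for y y'
      using that by (simp add: pullback_group_def)
  qed
  obtain \<kappa> where \<kappa>: "\<kappa> \<in> hom Z_fin D" "\<And>z. z \<in> carrier Z_fin \<Longrightarrow> \<kappa> z \<in> centre D"
    "\<And>C a. \<lbrakk>C \<in> FinC; a \<in> C\<rbrakk> \<Longrightarrow> \<kappa> (frag_of C) = e a [^]\<^bsub>D\<^esub> class_order G C"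
    by (rule kappa_exists) blast
  have \<kappa>_closed: "\<kappa> z \<in> carrier D" if "z \<in> carrier Z_fin" for z
    using hom_in_carrier [OF \<kappa>(1) that] .
  have class_rep: "\<exists>a. a \<in> C" if C: "C \<in> FinC" for C
  proof -
    obtain x where x: "x \<in> S" "C = cls x"
      using C fin_gen_classes_iff by blast
    then show ?thesis
      using conj_class_self [OF gen_closed [OF x(1)]] by blast
  qed
  have \<pi>_\<kappa>: "dehn_pi G \<Gamma> (\<kappa> z) = \<one>" if "z \<in> carrier Z_fin" for z
  proof -
    have keys: "Poly_Mapping.keys z \<subseteq> FinC"
      using that by simp
    have hom1: "dehn_pi G \<Gamma> \<circ> \<kappa> \<in> hom Z_fin G"
      by (rule Group.hom_compose [OF \<kappa>(1) dehn_pi_hom])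
    have hom2: "(\<lambda>_. \<one>) \<in> hom Z_fin G"
      by (simp add: hom_def)
    have "(dehn_pi G \<Gamma> \<circ> \<kappa>) z = (\<lambda>_. \<one>) z"
    proof (rule hom_free_Abelian_group_eqI [OF is_group hom1 hom2 _ keys])
      fix C
      assume C: "C \<in> FinC"
      then obtain a where a: "a \<in> C"
        using class_rep by blast
      note p = FinC_pow [OF C a]
      show "(dehn_pi G \<Gamma> \<circ> \<kappa>) (frag_of C) = \<one>"
        using \<kappa>(3) [OF C a] p(3) e_closed [OF p(1)] dehn_pi_e [OF p(1)] by (simp add: pi.hom_nat_pow)
    qed
    then show ?thesis
      by simp
  qed
  have Ab_\<kappa>: "dehn_Ab_fin G \<Gamma> (\<kappa> z) = scale_frag (class_order G) z" if "z \<in> carrier Z_fin" for z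
  proof -
    have keys: "Poly_Mapping.keys z \<subseteq> FinC"
      using that by simp
    have hom1: "dehn_Ab_fin G \<Gamma> \<circ> \<kappa> \<in> hom Z_fin Z_fin"
      by (rule Group.hom_compose [OF \<kappa>(1) dehn_Ab_fin_hom])
    have "(dehn_Ab_fin G \<Gamma> \<circ> \<kappa>) z = scale_frag (class_order G) z"
    proof (rule hom_free_Abelian_group_eqI [OF group_free_Abelian_group hom1 hom_scale_frag _ keys])
      fix C
      assume C: "C \<in> FinC"
      then obtain a where a: "a \<in> C"
        using class_rep by blast
      note p = FinC_pow [OF C a]
      have "dehn_Ab_fin G \<Gamma> (e a [^]\<^bsub>D\<^esub> class_order G C)
          = dehn_Ab_fin G \<Gamma> (e a) [^]\<^bsub>Z_fin\<^esub> class_order G C"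
        by (rule Ab.hom_nat_pow [OF e_closed [OF p(1)]])
      then show "(dehn_Ab_fin G \<Gamma> \<circ> \<kappa>) (frag_of C) = scale_frag (class_order G) (frag_of C)"
        using \<kappa>(3) [OF C a] dehn_Ab_fin_e [OF p(1)] p(2) C by (simp add: scale_frag_of)
    qed
    then show ?thesis
      by simp
  qed
  have inj: "inj_on ?F (carrier D)"
  proof (rule inj_onI)
    fix y y'
    assume y: "y \<in> carrier D" "y' \<in> carrier D" and eq: "?F y = ?F y'"
    let ?d = "y \<otimes>\<^bsub>D\<^esub> inv\<^bsub>D\<^esub> y'"
    have d: "?d \<in> carrier D"
      using y by simp
    have "dehn_pi G \<Gamma> ?d = \<one>"
      using y eq by simp
    then obtain z where z: "z \<in> carrier Z_fin" "?d = \<kappa> z"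
      using dehn_pi_kernel [OF \<kappa> d] by blast
    have "dehn_Ab_fin G \<Gamma> ?d = dehn_Ab_fin G \<Gamma> y \<otimes>\<^bsub>Z_fin\<^esub> inv\<^bsub>Z_fin\<^esub> dehn_Ab_fin G \<Gamma> y'"
      using y Ab.hom_mult [of y "inv\<^bsub>D\<^esub> y'"] Ab.hom_inv [of y'] by simp
    also have "\<dots> = \<one>\<^bsub>Z_fin\<^esub>"
      using eq Ab.H.r_inv [OF Ab.hom_closed [OF y(2)]] by simp
    finally have "scale_frag (class_order G) z = 0"
      using Ab_\<kappa> [OF z(1)] z(2) by simp
    \<comment> \<open>Nonzero class orders ensure that scaling loses no coordinate of
      \<open>z\<close>.\<close>
    moreover have "class_order G C \<noteq> 0" if "C \<in> Poly_Mapping.keys z" for C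
      using class_order_ge_2 [of C] that z(1) by auto
    ultimately have "z = 0"
      by (intro scale_frag_eq_0 [of z "class_order G"])
    then have "?d = \<one>\<^bsub>D\<^esub>"
      using z(2) hom_one [OF \<kappa>(1)] D.is_group by simp
    then show "y = y'"
      using y by (metis D.inv_closed D.inv_equality D.inv_inv)
  qed
  have surj: "p \<in> ?F ` carrier D" if "p \<in> carrier ?P" for p
  proof -
    obtain g x where p: "p = (g, x)" "g \<in> carrier G" "x \<in> carrier Z_fin" "Ab_fin G \<Gamma> g = pi_bar G \<Gamma> x"
      using \<open>p \<in> carrier ?P\<close> unfolding carrier_P by blast
    obtain y where y: "y \<in> carrier D" "dehn_pi G \<Gamma> y = g"
      using dehn_pi_surj [OF p(2)] by blast
    let ?x' = "dehn_Ab_fin G \<Gamma> y"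
    have x': "?x' \<in> carrier Z_fin"
      by (rule Ab.hom_closed [OF y(1)])
    have eq: "pi_bar G \<Gamma> x = pi_bar G \<Gamma> ?x'"
      using Ab_fin_dehn_pi [OF y(1)] y(2) p(4) by simp
    \<comment> \<open>\<open>y\<close> is an arbitrary lift of \<open>g\<close>, and
      \<open>?t\<close> is the error in its second coordinate. The error vanishes in
      \<open>G_fin\<close>, so it is \<open>scale_frag\<close> of some \<open>z\<close>, and the
      factor \<open>\<kappa> z\<close> corrects it without moving the first coordinate.\<close>
    let ?t = "inv\<^bsub>Z_fin\<^esub> ?x' \<otimes>\<^bsub>Z_fin\<^esub> x"
    have t: "?t \<in> carrier Z_fin"
      using Ab.H.m_closed [OF Ab.H.inv_closed [OF x'] p(3)] .
    have "pi_bar G \<Gamma> ?t = inv\<^bsub>G_fin G \<Gamma>\<^esub> pi_bar G \<Gamma> ?x' \<otimes>\<^bsub>G_fin G \<Gamma>\<^esub> pi_bar G \<Gamma> x"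
      using bar.hom_mult [OF Ab.H.inv_closed [OF x'] p(3)] bar.hom_inv [OF x'] by simp
    also have "\<dots> = \<one>\<^bsub>G_fin G \<Gamma>\<^esub>"
      using eq fin.l_inv [OF bar.hom_closed [OF x']] by simp
    finally obtain z where z: "z \<in> carrier Z_fin" "?t = scale_frag (class_order G) z"
      using pi_bar_kernel [OF t] by blast
    let ?y = "y \<otimes>\<^bsub>D\<^esub> \<kappa> z"
    have y': "?y \<in> carrier D"
      using y(1) \<kappa>_closed [OF z(1)] by simp
    have "dehn_pi G \<Gamma> ?y = g"
      using pi.hom_mult [OF y(1) \<kappa>_closed [OF z(1)]] \<pi>_\<kappa> [OF z(1)] y(2) p(2) by simp
    moreover have "dehn_Ab_fin G \<Gamma> ?y = ?x' \<otimes>\<^bsub>Z_fin\<^esub> ?t"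
      using Ab.hom_mult [OF y(1) \<kappa>_closed [OF z(1)]] Ab_\<kappa> [OF z(1)] z(2) by simp
    then have "dehn_Ab_fin G \<Gamma> ?y = x"
      using x' by simp
    ultimately show ?thesis
      using y' p(1) by blast
  qed
  show ?thesis
    using hom inj surj hom_carrier [OF hom] unfolding iso_def bij_betw_def by blast
qed

end

theorem proposition4p4:
  fixes G :: "('a, 'm) monoid_scheme"
    and S :: "'x set" and \<iota> :: "'x \<Rightarrow> 'a" and R :: "('x word \<times> 'x word) set"
    and \<Gamma> :: "'a set"
  assumes "group G"
    and "Cbar_presentation G S \<iota> R"
    and "\<Gamma> = \<iota> ` S"
  shows "(\<lambda>y. (dehn_pi G \<Gamma> y, dehn_Ab_fin G \<Gamma> y)) \<in>
           iso (dehn_group G \<Gamma>)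
               (pullback_group G (free_Abelian_group (fin_gen_classes G \<Gamma>))
                  (Ab_fin G \<Gamma>) (pi_bar G \<Gamma>))"
proof -
  interpret cbar_group G S \<iota> R \<Gamma>
    using assms by (simp add: cbar_group_def cbar_group_axioms_def)
  show ?thesis
    by (rule pullback_iso)
qed

end
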